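(* For $\alpha<\omega_1$ and $k\in\omega$: (i) $\mathrm{LT}_{<\omega\alpha+k+1}$ is $\mathbf{\Pi}^0_{2\alpha+2}$-complete; (ii) $\mathrm{LT}_{=\omega\alpha}$ is $\mathbf{\Pi}^0_{2\alpha+2}$-complete; (iii) $\mathrm{LT}_{=\omega\alpha+k+1}$ is $\mathbf{\Delta}^0_{2\alpha+3}$, but it is neither $\mathbf{\Sigma}^0_{2\alpha+2}$ nor $\mathbf{\Pi}^0_{2\alpha+2}$. In fact, it is a difference of two $\mathbf{\Pi}^0_{2\alpha+2}$ sets.
   Context: $\omega=\{0,1,2,\dots\}$. $\mathrm{Tr}$ is the space of all trees on $\omega$, i.e. subsets $T\subseteq\omega^{<\omega}$ closed downwards under initial segments and containing the empty sequence $\emptyset$, with the Polish topology inherited from the product space $2^{\omega^{<\omega}}$. The Lusin derivative of $T\in\mathrm{Tr}$ is $D(T)=\{s\in\omega^{<\omega}:\exists n\in\omega\ (s*(n)\in T)\}\cup\{\emptyset\}$, where $*$ denotes concatenation of finite sequences. Iterates: $D^0(T)=T$, $D^{\alpha+1}(T)=D(D^\alpha(T))$, and $D^\alpha(T)=\bigcap_{\xi<\alpha}D^\xi(T)$ for limit $\alpha$. The Lusin height $|T|$ is the least ordinal $\alpha$ with $D^{\alpha+1}(T)=D^\alpha(T)$ (it is countable). For $\alpha<\omega_1$, $\mathrm{LT}_{<\alpha}=\{T\in\mathrm{Tr}:|T|<\alpha\}$ and $\mathrm{LT}_{=\alpha}=\{T\in\mathrm{Tr}:|T|=\alpha\}$.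 Ordinal products are standard ordinal multiplication, $\omega\alpha=\omega\cdot\alpha$, $2\alpha=2\cdot\alpha$ (so $2\lambda=\lambda$ for limit $\lambda$). For a Polish space $Y$, $B\subseteq Y$ is $\mathbf{\Pi}^0_\xi$-hard if for every zero-dimensional Polish space $X$ and every $\mathbf{\Pi}^0_\xi$ set $A\subseteq X$ there is a continuous $f:X\to Y$ with $f^{-1}(B)=A$; $B$ is $\mathbf{\Pi}^0_\xi$-complete if it is $\mathbf{\Pi}^0_\xi$ and $\mathbf{\Pi}^0_\xi$-hard. *)

theory Defs
  imports "HOL-Analysis.Analysis" "HOL-Library.Sublist"
begin

section \<open>Countable ordinals\<close>

text \<open>The elements of \<open>cord\<close> are the countable ordinals: the well-order
  \<open>cardSuc natLeq\<close> has order type $\omega_1$.\<close>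

typedef cord = "Field (cardSuc natLeq)"
proof -
  have "Field (cardSuc natLeq) \<noteq> {}"
    using cardSuc_finite[OF natLeq_Card_order] by (auto simp: Field_natLeq)
  then show ?thesis by auto
qed

lemma Card_order_cardSuc_natLeq: "Card_order (cardSuc natLeq)"
  by (simp add: cardSuc_Card_order natLeq_Card_order)

lemma Well_order_cardSuc_natLeq: "Well_order (cardSuc natLeq)"
  using Card_order_cardSuc_natLeq card_order_on_well_order_on by blast

instantiation cord :: wellorder
begin

definition less_eq_cord :: "cord \<Rightarrow> cord \<Rightarrow> bool" where
  "less_eq_cord x y \<longleftrightarrow> (Rep_cord x, Rep_cord y) \<in> cardSuc natLeq"

definition less_cord :: "cord \<Rightarrow> cord \<Rightarrow> bool" where
  "less_cord x y \<longleftrightarrow> x \<le> y \<and> x \<noteq> y"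

instance
proof
  let ?r = "cardSuc natLeq"
  have lin: "Linear_order ?r"
    using Well_order_cardSuc_natLeq well_order_on_def by blast
  have tr: "trans ?r" and an: "antisym ?r" and rf: "refl_on (Field ?r) ?r"
    and tot: "total_on (Field ?r) ?r"
    using lin unfolding linear_order_on_def partial_order_on_def preorder_on_def by auto
  have wf: "wf (?r - Id)"
    using Well_order_cardSuc_natLeq well_order_on_def by blast
  fix x y z :: cord
  show ord_antisym: "x \<le> y \<Longrightarrow> y \<le> x \<Longrightarrow> x = y" for x y :: cord
    using an by (metis less_eq_cord_def antisymD Rep_cord_inject)
  show ord_refl: "x \<le> x" for x :: cord
    using rf Rep_cord by (auto simp: less_eq_cord_def refl_on_def)
  show "x < y \<longleftrightarrow> x \<le> y \<and> \<not> y \<le> x"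
    using ord_antisym[of x y] ord_refl[of x] by (auto simp: less_cord_def)
  show "x \<le> y \<Longrightarrow> y \<le> z \<Longrightarrow> x \<le> z"
    using tr by (auto simp: less_eq_cord_def dest: transD)
  show "x \<le> y \<or> y \<le> x"
  proof (cases "x = y")
    case False
    then have "Rep_cord x \<noteq> Rep_cord y" by (simp add: Rep_cord_inject)
    then show ?thesis
      using tot Rep_cord[of x] Rep_cord[of y] by (auto simp: less_eq_cord_def total_on_def)
  qed (simp add: ord_refl)
  fix P :: "cord \<Rightarrow> bool" and a :: cord
  assume *: "\<And>x. (\<And>y. y < x \<Longrightarrow> P y) \<Longrightarrow> P x"
  have "wf {(x, y). x < (y :: cord)}"
    by (rule wf_subset[OF wf_inv_image[OF wf, of Rep_cord]])
      (auto simp: inv_image_def less_cord_def less_eq_cord_def Rep_cord_inject)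
  then show "P a"
    by (rule wf_induct) (use * in auto)
qed

end

lemma countable_iff_natLeq:
  includes cardinal_syntax
  shows "countable A \<longleftrightarrow> |A| \<le>o natLeq"
proof -
  have "countable A \<longleftrightarrow> |A| \<le>o |UNIV :: nat set|"
    unfolding countable_def card_of_ordLeq[symmetric] by simp
  then show ?thesis
    by (meson card_of_nat ordIso_symmetric ordLeq_ordIso_trans)
qed

lemma countable_lessThan_cord:
  includes cardinal_syntax
  shows "countable {..<a :: cord}"
proof -
  let ?r = "cardSuc natLeq"
  have "Rep_cord ` {..<a} \<subseteq> underS ?r (Rep_cord a)"
    by (auto simp: underS_def less_cord_def less_eq_cord_def Rep_cord_inject)
  moreover have "|underS ?r (Rep_cord a)| <o ?r"
    by (rule card_of_underS[OF Card_order_cardSuc_natLeq Rep_cord])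
  then have "|underS ?r (Rep_cord a)| \<le>o natLeq"
    using cardSuc_ordLeq_ordLess[OF natLeq_Card_order card_of_Card_order] by blast
  then have "countable (underS ?r (Rep_cord a))"
    by (simp add: countable_iff_natLeq)
  ultimately have "countable (Rep_cord ` {..<a})"
    using countable_subset by blast
  then show ?thesis
    by (rule countable_image_inj_on) (simp add: inj_on_def Rep_cord_inject)
qed

lemma countable_bounded_cord:
  includes cardinal_syntax
  assumes "countable S"
  shows "\<exists>b :: cord. \<forall>s\<in>S. s < b"
proof -
  let ?r = "cardSuc natLeq"
  have bd: "\<exists>b :: cord. \<forall>s\<in>S. s \<le> b" if S: "countable S" for S
  proof (rule ccontr)
    assume "\<not> ?thesis"
    then have *: "\<exists>s\<in>S. b < s" for b by (auto simp: not_le)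
    have "cofinal (Rep_cord ` S) ?r"
      unfolding cofinal_def
    proof
      fix a assume "a \<in> Field ?r"
      then obtain b where "a = Rep_cord b" by (metis Rep_cord_cases)
      then show "\<exists>b\<in>Rep_cord ` S. a \<noteq> b \<and> (a, b) \<in> ?r"
        using *[of b] by (auto simp: less_cord_def less_eq_cord_def Rep_cord_inject)
    qed
    moreover have "Rep_cord ` S \<subseteq> Field ?r" using Rep_cord by auto
    moreover have "regularCard ?r"
      using infinite_cardSuc_regularCard[OF _ natLeq_Card_order] by (simp add: Field_natLeq)
    ultimately have "|Rep_cord ` S| =o ?r"
      unfolding regularCard_def by blast
    moreover have "|Rep_cord ` S| \<le>o natLeq"
      using S by (simp add: countable_iff_natLeq[symmetric])
    ultimately have "?r \<le>o natLeq"
      using ordIso_ordLeq_trans ordIso_symmetric by blast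
    then show False
      using cardSuc_greater[OF natLeq_Card_order] not_ordLess_ordLeq by blast
  qed
  have strict: "\<exists>b :: cord. a < b" for a
  proof (rule ccontr)
    assume "\<not> ?thesis"
    then have "UNIV = insert a {..<a}" by (auto simp: not_less order.order_iff_strict)
    then have "countable (UNIV :: cord set)"
      by (metis countable_insert countable_lessThan_cord)
    then have "countable (Rep_cord ` UNIV)" by blast
    then have "countable (Field ?r)"
      by (metis type_definition.Rep_range type_definition_cord)
    then have "|Field ?r| \<le>o natLeq" by (simp add: countable_iff_natLeq)
    then have "?r \<le>o natLeq"
      using card_of_Field_ordIso[OF Card_order_cardSuc_natLeq]
        ordIso_ordLeq_trans ordIso_symmetric by blast
    then show False
      using cardSuc_greater[OF natLeq_Card_order] not_ordLess_ordLeq by blast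
  qed
  obtain a where "\<forall>s\<in>S. s \<le> a" using bd[OF assms] by auto
  moreover obtain b where "a < b" using strict by auto
  ultimately show ?thesis by (meson le_less_trans)
qed

instantiation cord :: zero
begin
definition zero_cord :: cord where "zero_cord = (LEAST x. True)"
instance ..
end

lemma zero_le_cord [simp]: "0 \<le> (x :: cord)"
  by (simp add: zero_cord_def Least_le)

lemma not_less_zero_cord [simp]: "\<not> x < (0 :: cord)"
  by (simp add: not_less)

definition osuc :: "cord \<Rightarrow> cord" where
  "osuc x = (LEAST y. x < y)"

definition olimit :: "cord \<Rightarrow> bool" where
  "olimit x \<longleftrightarrow> x \<noteq> 0 \<and> (\<forall>y. x \<noteq> osuc y)"

definition osup :: "cord set \<Rightarrow> cord" where
  "osup S = (LEAST y. \<forall>x\<in>S. x \<le> y)"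

lemma less_osuc [simp]: "x < osuc x"
  using countable_bounded_cord[of "{x}"] unfolding osuc_def by (auto intro: LeastI_ex)

lemma osuc_le_iff [simp]: "osuc x \<le> y \<longleftrightarrow> x < y"
  by (metis Least_le less_osuc less_le_trans osuc_def)

lemma less_osuc_iff [simp]: "x < osuc y \<longleftrightarrow> x \<le> y"
  by (meson not_less osuc_le_iff)

lemma osuc_inject [simp]: "osuc x = osuc y \<longleftrightarrow> x = y"
  by (metis less_osuc_iff order_antisym order_refl)

lemma osuc_neq_zero [simp]: "osuc x \<noteq> 0"
proof
  assume "osuc x = 0"
  then have "x < 0" using less_osuc[of x] by metis
  then show False by simp
qed

lemma osup_upper: "countable S \<Longrightarrow> x \<in> S \<Longrightarrow> x \<le> osup S"
proof -
  assume S: "countable S" "x \<in> S"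
  obtain b where "\<forall>s\<in>S. s \<le> b"
    using countable_bounded_cord[OF S(1)] less_imp_le by blast
  then have "\<forall>s\<in>S. s \<le> osup S"
    unfolding osup_def by (rule LeastI)
  then show ?thesis using S(2) by blast
qed

lemma osup_least: "(\<And>x. x \<in> S \<Longrightarrow> x \<le> y) \<Longrightarrow> osup S \<le> y"
  unfolding osup_def by (simp add: Least_le)

lemma not_olimit_osuc [simp]: "\<not> olimit (osuc x)"
  by (auto simp: olimit_def)

lemma not_olimit_0 [simp]: "\<not> olimit 0"
  by (auto simp: olimit_def)

lemma olimit_osuc_less: "olimit x \<Longrightarrow> y < x \<Longrightarrow> osuc y < x"
  using osuc_le_iff[of y x] by (auto simp del: osuc_le_iff simp: le_less olimit_def)

lemma cord_cases:
  obtains "x = 0" | y where "x = osuc y" | "olimit x"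
  unfolding olimit_def by blast

lemma cord_induct [case_names zero osuc olimit]:
  assumes "P 0" "\<And>x. P x \<Longrightarrow> P (osuc x)" "\<And>x. olimit x \<Longrightarrow> (\<And>y. y < x \<Longrightarrow> P y) \<Longrightarrow> P x"
  shows "P (x :: cord)"
proof (induction x rule: less_induct)
  case (less x)
  show ?case by (cases x rule: cord_cases) (use less assms in auto)
qed

function cord_rec :: "'a \<Rightarrow> ('a \<Rightarrow> 'a) \<Rightarrow> ('a set \<Rightarrow> 'a) \<Rightarrow> cord \<Rightarrow> 'a" where
  "cord_rec z s l x =
    (if x = 0 then z
     else if olimit x then l (cord_rec z s l ` {..<x})
     else s (cord_rec z s l (THE y. x = osuc y)))"
  by auto
termination
proof (relation "inv_image {(x, y). x < y} (\<lambda>(z, s, l, x). x)")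
  show "wf (inv_image {(x, y). x < y} (\<lambda>(z :: 'a, s :: 'a \<Rightarrow> 'a, l :: 'a set \<Rightarrow> 'a, x :: cord). x))"
    by (simp add: wf)
qed (auto simp: olimit_def)

declare cord_rec.simps [simp del]

lemma cord_rec_0 [simp]: "cord_rec z s l 0 = z"
  by (simp add: cord_rec.simps)

lemma cord_rec_osuc [simp]: "cord_rec z s l (osuc x) = s (cord_rec z s l x)"
  by (subst cord_rec.simps) simp

lemma cord_rec_olimit: "olimit x \<Longrightarrow> cord_rec z s l x = l (cord_rec z s l ` {..<x})"
  by (subst cord_rec.simps) auto

instantiation cord :: "{one, plus, times}"
begin

definition one_cord :: cord where
  "one_cord = osuc 0"

definition plus_cord :: "cord \<Rightarrow> cord \<Rightarrow> cord" where
  "plus_cord x y = cord_rec x osuc osup y"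

definition times_cord :: "cord \<Rightarrow> cord \<Rightarrow> cord" where
  "times_cord x y = cord_rec 0 (\<lambda>z. z + x) osup y"

instance ..

end

lemma cord_add_0 [simp]: "x + 0 = (x :: cord)"
  by (simp add: plus_cord_def)

lemma cord_add_osuc [simp]: "x + osuc y = osuc (x + y)"
  by (simp add: plus_cord_def)

lemma cord_add_olimit: "olimit y \<Longrightarrow> x + y = osup ((\<lambda>z. x + z) ` {..<y})"
  unfolding plus_cord_def by (rule cord_rec_olimit)

lemma cord_mult_0 [simp]: "x * 0 = (0 :: cord)"
  by (simp add: times_cord_def)

lemma cord_mult_osuc [simp]: "x * osuc y = x * y + x"
  by (simp add: times_cord_def)

lemma cord_mult_olimit: "olimit y \<Longrightarrow> x * y = osup ((\<lambda>z. x * z) ` {..<y})"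
  unfolding times_cord_def by (rule cord_rec_olimit)

lemma less_osup_ex: "y < osup S \<Longrightarrow> \<exists>x\<in>S. y < x"
  using osup_least[of S y] by (auto simp flip: not_le)

lemma cord_add_strict_mono: "y < z \<Longrightarrow> x + y < x + (z :: cord)"
proof (induction z rule: cord_induct)
  case zero
  then show ?case by simp
next
  case (osuc z)
  then have "y < z \<or> y = z" by auto
  then have "x + y \<le> x + z" using osuc.IH by auto
  then show ?case by simp
next
  case (olimit z)
  then have "osuc y < z" by (simp add: olimit_osuc_less)
  then have "x + osuc y \<le> x + z"
    unfolding cord_add_olimit[OF olimit(1)]
    by (intro osup_upper countable_image countable_lessThan_cord imageI) simp
  then show ?case by simp
qed

lemma cord_add_mono: "y \<le> z \<Longrightarrow> x + y \<le> x + (z :: cord)"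
  using cord_add_strict_mono by (auto simp: order.order_iff_strict)

lemma cord_zero_add [simp]: "0 + x = (x :: cord)"
proof (induction x rule: cord_induct)
  case (olimit x)
  then have eq: "0 + x = osup {..<x}"
    by (simp add: cord_add_olimit)
  have "osup {..<x} \<le> x" by (rule osup_least) auto
  moreover have "\<not> osup {..<x} < x"
  proof
    assume "osup {..<x} < x"
    then have "osuc (osup {..<x}) < x" using olimit by (simp add: olimit_osuc_less)
    then have "osuc (osup {..<x}) \<le> osup {..<x}"
      by (intro osup_upper) (auto simp: countable_lessThan_cord)
    then show False by simp
  qed
  ultimately show ?case using eq by simp
qed auto

lemma olimit_add: "olimit y \<Longrightarrow> olimit (x + y)"
proof -
  assume y: "olimit y"
  then have "y \<noteq> 0" by auto
  then have "0 < y" using zero_le_cord[of y] by (simp add: order.order_iff_strict)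
  then have "x + y \<noteq> 0"
    using cord_add_strict_mono[of 0 y x] by auto
  moreover have "x + y \<noteq> osuc w" for w
  proof
    assume w: "x + y = osuc w"
    then have "w < osup ((\<lambda>z. x + z) ` {..<y})"
      using cord_add_olimit[OF y, of x] less_osuc[of w] by simp
    then obtain z where "z < y" "w < x + z" by (auto dest: less_osup_ex)
    then have "x + y \<le> x + z" "x + z < x + y" using w cord_add_strict_mono[of z y x] by simp_all
    then show False by simp
  qed
  ultimately show ?thesis by (simp add: olimit_def)
qed

lemma cord_add_assoc: "(x + y) + z = x + (y + z :: cord)"
proof (induction z rule: cord_induct)
  case (olimit z)
  have L: "(x + y) + z = osup ((\<lambda>w. x + (y + w)) ` {..<z})"
    unfolding cord_add_olimit[OF olimit(1)] using olimit(2)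
    by (intro arg_cong[where f = osup] image_cong) auto
  have "osup ((\<lambda>w. x + (y + w)) ` {..<z}) \<le> x + (y + z)"
    by (rule osup_least) (auto intro!: cord_add_mono)
  moreover have "x + (y + z) \<le> osup ((\<lambda>w. x + (y + w)) ` {..<z})"
    unfolding cord_add_olimit[OF olimit_add[OF olimit(1)], of x y]
  proof (rule osup_least)
    fix v assume "v \<in> (+) x ` {..<y + z}"
    then obtain u where u: "v = x + u" "u < y + z" by auto
    then obtain w where w: "w < z" "u < y + w"
      unfolding cord_add_olimit[OF olimit(1), of y] by (auto dest: less_osup_ex)
    have "v \<le> x + (y + w)" using u w by (auto intro!: cord_add_mono)
    also have "\<dots> \<le> osup ((\<lambda>w. x + (y + w)) ` {..<z})"
      using w by (intro osup_upper) (auto simp: countable_lessThan_cord)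
    finally show "v \<le> osup ((\<lambda>w. x + (y + w)) ` {..<z})" .
  qed
  ultimately show ?case using L by simp
qed auto

instance cord :: monoid_add
  by standard (simp_all add: cord_add_assoc)

instance cord :: numeral ..

lemma cord_add_1: "x + 1 = osuc x"
  by (simp add: one_cord_def)

definition ord_of_nat :: "nat \<Rightarrow> cord" where
  "ord_of_nat n = (osuc ^^ n) 0"

definition omega :: cord  ("\<omega>") where
  "\<omega> = (LEAST x. olimit x)"

lemma olimit_omega: "olimit \<omega>"
proof -
  let ?w = "osup (range ord_of_nat)"
  have le: "ord_of_nat n \<le> ?w" for n
    by (rule osup_upper) auto
  have Suc: "ord_of_nat (Suc n) = osuc (ord_of_nat n)" for n
    by (simp add: ord_of_nat_def)
  have lt: "ord_of_nat n < ?w" for n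
    using le[of "Suc n"] by (simp add: Suc)
  have "?w \<noteq> 0"
    using lt[of 0] by auto
  moreover have "?w \<noteq> osuc y" for y
  proof
    assume y: "?w = osuc y"
    then have "y < ?w" by simp
    then obtain n where "y < ord_of_nat n" by (auto dest: less_osup_ex)
    then show False using lt[of n] y by simp
  qed
  ultimately have "olimit ?w" by (simp add: olimit_def)
  then show ?thesis unfolding omega_def by (rule LeastI)
qed


section \<open>The Borel hierarchy\<close>

text \<open>In the second rule the sets \<open>A n\<close> are $\mathbf{\Pi}^0_{\eta_n}$. All classes with index
  \<open>0\<close> are empty.\<close>

inductive Sigma0 :: "'a topology \<Rightarrow> cord \<Rightarrow> 'a set \<Rightarrow> bool" for X where
  open_set: "openin X U \<Longrightarrow> Sigma0 X 1 U"
| countable_union: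
    "1 < \<xi> \<Longrightarrow>
     (\<And>n :: nat. 1 \<le> \<eta> n \<and> \<eta> n < \<xi> \<and> A n \<subseteq> topspace X \<and>
        Sigma0 X (\<eta> n) (topspace X - A n)) \<Longrightarrow>
     Sigma0 X \<xi> (\<Union>n. A n)"

definition Pi0 :: "'a topology \<Rightarrow> cord \<Rightarrow> 'a set \<Rightarrow> bool" where
  "Pi0 X \<xi> A \<longleftrightarrow> A \<subseteq> topspace X \<and> Sigma0 X \<xi> (topspace X - A)"

definition Delta0 :: "'a topology \<Rightarrow> cord \<Rightarrow> 'a set \<Rightarrow> bool" where
  "Delta0 X \<xi> A \<longleftrightarrow> Sigma0 X \<xi> A \<and> Pi0 X \<xi> A"

definition Polish_space :: "'a topology \<Rightarrow> bool" where
  "Polish_space X \<longleftrightarrow> completely_metrizable_space X \<and> second_countable X"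

text \<open>A HOL predicate cannot quantify over the types carrying the spaces \<open>X\<close>, so that type is
  an explicit parameter; a theorem in which it is a type variable covers all spaces \<open>X\<close>.
  By \<open>dimension_le_0_neighbourhood_base_of_clopen\<close>, \<open>X dim_le 0\<close> says that \<open>X\<close> has a base of
  clopen sets.\<close>

definition Pi0_hard :: "'x itself \<Rightarrow> cord \<Rightarrow> 'a topology \<Rightarrow> 'a set \<Rightarrow> bool" where
  "Pi0_hard _ \<xi> Y B \<longleftrightarrow>
     (\<forall>(X :: 'x topology) A. Polish_space X \<and> X dim_le 0 \<and> Pi0 X \<xi> A \<longrightarrow>
        (\<exists>f. continuous_map X Y f \<and> {x \<in> topspace X. f x \<in> B} = A))"

definition Pi0_complete :: "'x itself \<Rightarrow> cord \<Rightarrow> 'a topology \<Rightarrow> 'a set \<Rightarrow> bool" where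
  "Pi0_complete T \<xi> Y B \<longleftrightarrow> Pi0 Y \<xi> B \<and> Pi0_hard T \<xi> Y B"


section \<open>Trees and the Lusin derivative\<close>

definition Tr :: "nat list set set" where
  "Tr = {T. [] \<in> T \<and> (\<forall>s t. t \<in> T \<and> prefix s t \<longrightarrow> s \<in> T)}"

text \<open>Trees are identified with their characteristic functions in $2^{\omega^{<\omega}}$.\<close>

definition Tr_space :: "nat list set topology" where
  "Tr_space =
     pullback_topology Tr (\<lambda>T s. s \<in> T)
       (product_topology (\<lambda>_. discrete_topology (UNIV :: bool set)) UNIV)"

lemma topspace_Tr_space [simp]: "topspace Tr_space = Tr"
  by (simp add: Tr_space_def topspace_pullback_topology)

definition lusin_deriv :: "nat list set \<Rightarrow> nat list set" where
  "lusin_deriv T = {s. \<exists>n. s @ [n] \<in> T} \<union> {[]}"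

definition lusin_iter :: "cord \<Rightarrow> nat list set \<Rightarrow> nat list set" where
  "lusin_iter \<alpha> T = cord_rec T lusin_deriv Inter \<alpha>"

definition lusin_height :: "nat list set \<Rightarrow> cord" where
  "lusin_height T = (LEAST \<alpha>. lusin_iter (\<alpha> + 1) T = lusin_iter \<alpha> T)"

lemma lusin_iter_0 [simp]: "lusin_iter 0 T = T"
  by (simp add: lusin_iter_def)

lemma lusin_iter_osuc [simp]: "lusin_iter (osuc \<alpha>) T = lusin_deriv (lusin_iter \<alpha> T)"
  by (simp add: lusin_iter_def)

lemma lusin_iter_olimit: "olimit \<alpha> \<Longrightarrow> lusin_iter \<alpha> T = (\<Inter>\<xi><\<alpha>. lusin_iter \<xi> T)"
  by (simp add: lusin_iter_def cord_rec_olimit)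

lemma lusin_deriv_subset: "T \<in> Tr \<Longrightarrow> lusin_deriv T \<subseteq> T"
  by (force simp: Tr_def lusin_deriv_def)

lemma lusin_deriv_Tr: "T \<in> Tr \<Longrightarrow> lusin_deriv T \<in> Tr"
proof -
  assume T: "T \<in> Tr"
  have "s \<in> lusin_deriv T" if t: "t \<in> lusin_deriv T" and st: "prefix s t" for s t
  proof (cases "s = [] \<or> s = t")
    case True
    then show ?thesis using t by (auto simp: lusin_deriv_def)
  next
    case False
    then obtain v where "t = s @ v" "v \<noteq> []"
      using st by (auto simp: prefix_def)
    then obtain n u where "t = s @ n # u"
      by (cases v) auto
    moreover have "t \<in> T" using lusin_deriv_subset[OF T] t by auto
    moreover have "prefix (s @ [n]) (s @ n # u)" by simp
    ultimately have "s @ [n] \<in> T" using T unfolding Tr_def by blast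
    then show ?thesis by (auto simp: lusin_deriv_def)
  qed
  then show ?thesis unfolding Tr_def by (auto simp: lusin_deriv_def)
qed

lemma lusin_iter_Tr: "T \<in> Tr \<Longrightarrow> lusin_iter \<alpha> T \<in> Tr"
proof (induction \<alpha> rule: cord_induct)
  case (olimit \<alpha>)
  have IH: "lusin_iter \<xi> T \<in> Tr" if "\<xi> < \<alpha>" for \<xi>
    using olimit that by blast
  show ?case
    unfolding lusin_iter_olimit[OF olimit(1)]
    using IH[unfolded Tr_def mem_Collect_eq] by (simp add: Tr_def) blast
qed (auto simp: lusin_deriv_Tr)

lemma lusin_iter_antimono:
  assumes "T \<in> Tr" "\<alpha> \<le> \<beta>"
  shows "lusin_iter \<beta> T \<subseteq> lusin_iter \<alpha> T"
  using assms(2)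
proof (induction \<beta> rule: cord_induct)
  case zero
  then have "\<alpha> = 0" using zero_le_cord[of \<alpha>] order_antisym by blast
  then show ?case by simp
next
  case (osuc \<beta>)
  show ?case
  proof (cases "\<alpha> = osuc \<beta>")
    case False
    with osuc have "lusin_iter \<beta> T \<subseteq> lusin_iter \<alpha> T"
      by (simp add: le_less)
    then show ?thesis
      using lusin_deriv_subset[OF lusin_iter_Tr[OF assms(1)], of \<beta>] by auto
  qed simp
next
  case (olimit \<beta>)
  then show ?case by (auto simp: lusin_iter_olimit le_less)
qed

text \<open>The height exists as a countable ordinal, so the \<open>LEAST\<close> in its definition is attained.\<close>

lemma lusin_height_attained:
  assumes "T \<in> Tr"
  shows "lusin_iter (lusin_height T + 1) T = lusin_iter (lusin_height T) T"
proof -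
  have "\<exists>\<alpha>. lusin_iter (\<alpha> + 1) T = lusin_iter \<alpha> T"
  proof (rule ccontr)
    assume "\<not> ?thesis"
    then have "\<exists>s. s \<in> lusin_iter \<alpha> T - lusin_iter (osuc \<alpha>) T" for \<alpha>
      using lusin_iter_antimono[OF assms, of \<alpha> "osuc \<alpha>"] cord_add_1[of \<alpha>]
      by (metis Diff_iff less_imp_le less_osuc subsetI subset_antisym)
    then obtain f where f: "\<And>\<alpha>. f \<alpha> \<in> lusin_iter \<alpha> T - lusin_iter (osuc \<alpha>) T"
      by metis
    have "f \<alpha> \<noteq> f \<beta>" if "\<alpha> < \<beta>" for \<alpha> \<beta>
      using f[of \<alpha>] f[of \<beta>] lusin_iter_antimono[OF assms, of "osuc \<alpha>" \<beta>] that
      by (metis DiffD1 DiffD2 osuc_le_iff subsetD)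
    then have "inj f" by (metis injI linorder_neqE)
    then have "countable (UNIV :: cord set)"
      by (metis countableI_type countable_image_inj_on)
    then show False using countable_bounded_cord[of UNIV] by blast
  qed
  then show ?thesis unfolding lusin_height_def by (rule LeastI_ex)
qed

definition LT_less :: "cord \<Rightarrow> nat list set set" where
  "LT_less \<alpha> = {T \<in> Tr. lusin_height T < \<alpha>}"

definition LT_eq :: "cord \<Rightarrow> nat list set set" where
  "LT_eq \<alpha> = {T \<in> Tr. lusin_height T = \<alpha>}"

end

theory Submission
  imports Defs
begin

text \<open>By induction on \<open>\<alpha>\<close>,
  a $\mathbf{\Sigma}^0_{2\alpha+1}$ set \<open>B\<close> is coded by trees \<open>g x\<close> depending continuously on \<open>x\<close>:
  if \<open>x \<in> B\<close>, then \<open>g x\<close> has an infinite branch and all its well-founded nodes have rank below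
  \<open>\<omega>\<alpha>\<close>; otherwise \<open>g x\<close> has rank exactly \<open>\<omega>\<alpha>\<close>. Countable unions are obtained by joining
  trees at a new root, together with fixed trees of ranks cofinal in \<open>\<omega>\<alpha>\<close>. Countable intersections
  are obtained by a staggered product: it is ill-founded iff all factors are, and the
  rank of a node exceeds the rank of a factor by at most a finite amount, which
  stays below \<open>\<omega>\<alpha>\<close>. Joining the trees of the sets in a countable intersection \<open>A\<close> gives a tree of
  height \<open>\<omega>\<alpha> + k\<close> or \<open>\<omega>\<alpha> + k + 1\<close> according to \<open>x \<in> A\<close>; this single reduction yields all
  lower bounds, the ones in (iii) because $\mathbf{\Pi}^0_\xi$ is not contained in
  $\mathbf{\Sigma}^0_\xi$ on Cantor space. The upper bounds follow from
  \<open>{T. s \<in> D\<^sup>\<omega>\<^sup>\<alpha>(T)}\<close> being $\mathbf{\Delta}^0_{2\alpha+1}$ for nonempty \<open>s\<close>.\<close>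


section \<open>The ordinals \<open>2\<alpha>\<close> and \<open>\<omega>\<alpha>\<close>\<close>

lemma cord_add_2: "x + 2 = osuc (osuc x)"
proof -
  have *: "(2 :: cord) = osuc 1" by (simp only: cord_add_1[symmetric] one_add_one)
  show ?thesis unfolding * one_cord_def by simp
qed

lemma cord_add_3: "x + 3 = osuc (osuc (osuc x))"
proof -
  have *: "(3 :: cord) = osuc 2" by (simp only: cord_add_1[symmetric] numeral.simps)
  show ?thesis unfolding * by (simp add: cord_add_2)
qed

lemma osuc_neq_self [simp]: "osuc x \<noteq> x"
  by (metis less_irrefl less_osuc)

lemma cord_pos_iff: "0 < x \<longleftrightarrow> x \<noteq> (0 :: cord)"
  by (metis order.order_iff_strict order_less_irrefl zero_le_cord)

lemma cord_one_le_iff: "1 \<le> x \<longleftrightarrow> x \<noteq> (0 :: cord)"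
  by (simp add: one_cord_def cord_pos_iff)

lemma cord_add_ord_of_nat: "x + ord_of_nat n = (osuc ^^ n) x"
  by (induction n) (simp_all add: ord_of_nat_def)

lemma ord_of_nat_less_omega: "ord_of_nat n < \<omega>"
proof (induction n)
  case 0
  then show ?case
    using olimit_omega by (auto simp: ord_of_nat_def cord_pos_iff)
next
  case (Suc n)
  then show ?case using olimit_osuc_less[OF olimit_omega] by (simp add: ord_of_nat_def)
qed

text \<open>A limit below \<open>\<omega>\<close> would contradict the choice of
  \<open>\<omega>\<close> as the least limit.\<close>

lemma less_omegaD: "z < \<omega> \<Longrightarrow> \<exists>n. z = ord_of_nat n"
proof (induction z rule: cord_induct)
  case zero
  show ?case by (rule exI[of _ 0]) (simp add: ord_of_nat_def)
next
  case (osuc x)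
  then obtain n where "x = ord_of_nat n" using less_osuc less_trans by metis
  then show ?case by (intro exI[of _ "Suc n"]) (simp add: ord_of_nat_def)
next
  case (olimit x)
  then show ?case unfolding omega_def using not_less_Least by blast
qed

lemma cord_mult_mono: "y \<le> z \<Longrightarrow> x * y \<le> x * (z :: cord)"
proof (induction z rule: cord_induct)
  case zero
  then show ?case by (metis order_antisym order_refl zero_le_cord)
next
  case (osuc z)
  have "x * z \<le> x * osuc z" using cord_add_mono[of 0 x "x * z"] by simp
  with osuc show ?case by (metis le_less less_osuc_iff order_trans)
next
  case (olimit z)
  show ?case
  proof (cases "y = z")
    case False
    with olimit show ?thesis
      unfolding cord_mult_olimit[OF olimit(1)]
      by (intro osup_upper) (auto simp: countable_lessThan_cord)
  qed simp
qed

lemma less_cord_multD: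
  assumes "y < x * (z :: cord)"
  shows "\<exists>w<z. y < x * w + x"
proof (cases z rule: cord_cases)
  case 1
  with assms show ?thesis by simp
next
  case (2 w)
  with assms show ?thesis by (auto intro: exI[of _ w])
next
  case 3
  from assms obtain w where "w < z" "y < x * w"
    unfolding cord_mult_olimit[OF 3] by (auto dest: less_osup_ex)
  then show ?thesis
    using cord_add_mono[of 0 x "x * w"] by (auto intro!: exI[of _ w])
qed

text \<open>Every index below an even one is thus raised to an odd index still below it, the form in
  which the codings by trees are constructed.\<close>

lemma less_two_multD: "y < 2 * z \<Longrightarrow> \<exists>w<z. y \<le> osuc (2 * w)"
  using less_cord_multD[of y 2 z] by (auto simp: cord_add_2)

lemma two_mult_less:
  assumes "w < z" shows "osuc (2 * w) < 2 * z"
proof -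
  have "2 * osuc w \<le> 2 * z" by (rule cord_mult_mono) (use assms in simp)
  then show ?thesis by (simp add: cord_add_2)
qed

lemma omega_mult_less:
  assumes "w < z" shows "\<omega> * w + ord_of_nat n < \<omega> * z"
proof -
  have "\<omega> * w + ord_of_nat n < \<omega> * osuc w"
    using cord_add_strict_mono[OF ord_of_nat_less_omega] by simp
  also have "\<dots> \<le> \<omega> * z" by (rule cord_mult_mono) (use assms in simp)
  finally show ?thesis .
qed

text \<open>With \<open>omega_mult_less\<close>, the ordinals \<open>\<omega> * w + n\<close> with
  \<open>w < z\<close> are cofinal in \<open>\<omega> * z\<close>; finite increments of rank
  therefore never reach \<open>\<omega> * z\<close>.\<close>

lemma less_omega_multD:
  assumes "y < \<omega> * z" shows "\<exists>w n. w < z \<and> y < \<omega> * w + ord_of_nat n"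
proof -
  from assms obtain w where w: "w < z" "y < \<omega> * w + \<omega>" using less_cord_multD by blast
  then obtain v where "v < \<omega>" "y < \<omega> * w + v"
    unfolding cord_add_olimit[OF olimit_omega] by (auto dest: less_osup_ex)
  with w less_omegaD show ?thesis by blast
qed

lemma omega_mult_pos: "z \<noteq> 0 \<Longrightarrow> 0 < \<omega> * z"
  using omega_mult_less[of 0 z 0] by (simp add: cord_pos_iff ord_of_nat_def)

lemma olimit_omega_mult:
  assumes "z \<noteq> 0" shows "olimit (\<omega> * z)"
proof -
  have "\<omega> * z \<noteq> osuc y" for y
  proof
    assume y: "\<omega> * z = osuc y"
    then have "y < \<omega> * z" by simp
    then obtain w n where w: "w < z" "y < \<omega> * w + ord_of_nat n" using less_omega_multD by blast
    have "osuc y < \<omega> * w + ord_of_nat (Suc n)"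
      using w(2) by (simp add: cord_add_ord_of_nat)
    with omega_mult_less[OF w(1), of "Suc n"] y show False by (metis less_asym)
  qed
  then show ?thesis using omega_mult_pos[OF assms] by (auto simp: olimit_def)
qed


section \<open>Spaces with a countable clopen base\<close>

text \<open>The common property of zero-dimensional Polish spaces, Cantor space and
  \<open>Tr_space\<close> on which the arguments rest. Indexing by naturals fits the countable
  unions in \<open>Sigma0\<close>.\<close>

definition clopen_base :: "'a topology \<Rightarrow> (nat \<Rightarrow> 'a set) \<Rightarrow> bool" where
  "clopen_base X C \<longleftrightarrow>
     (\<forall>n. openin X (C n) \<and> closedin X (C n)) \<and>
     (\<forall>U. openin X U \<longrightarrow> (\<forall>x\<in>U. \<exists>n. x \<in> C n \<and> C n \<subseteq> U))"

definition has_clopen_base :: "'a topology \<Rightarrow> bool" where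
  "has_clopen_base X \<longleftrightarrow> (\<exists>C. clopen_base X C)"

lemma clopen_baseD: "clopen_base X C \<Longrightarrow> openin X (C n) \<and> closedin X (C n)"
  unfolding clopen_base_def by blast

lemma has_clopen_baseI:
  assumes "countable F" "\<And>V. V \<in> F \<Longrightarrow> openin X V \<and> closedin X V"
    and "\<And>U x. openin X U \<Longrightarrow> x \<in> U \<Longrightarrow> \<exists>V\<in>F. x \<in> V \<and> V \<subseteq> U"
  shows "has_clopen_base X"
proof -
  let ?C = "from_nat_into (insert {} F)"
  have r: "range ?C = insert {} F"
    using assms(1) by (intro range_from_nat_into) auto
  have "openin X (?C n) \<and> closedin X (?C n)" for n
    using r assms(2) by (metis (full_types) closedin_empty insert_iff openin_empty rangeI)
  moreover have "\<exists>n. x \<in> ?C n \<and> ?C n \<subseteq> U" if U: "openin X U" "x \<in> U" for x U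
  proof -
    obtain V where "V \<in> F" "x \<in> V" "V \<subseteq> U" using assms(3)[OF U] by blast
    moreover then obtain n where "?C n = V" using r by (metis insertI2 rangeE)
    ultimately show ?thesis by blast
  qed
  ultimately show ?thesis
    unfolding has_clopen_base_def clopen_base_def by blast
qed

text \<open>The clopen sets need not be countable in number. One is therefore chosen for each pair
  \<open>W\<close>, \<open>W'\<close> of basic sets that has a clopen set in between; for
  \<open>x\<close> in \<open>W\<close> it is a clopen neighbourhood inside
  \<open>W'\<close>.\<close>

lemma has_clopen_base_zero_dim:
  assumes "second_countable X" "X dim_le 0"
  shows "has_clopen_base X"
proof -
  obtain B where B: "countable B" "\<And>V. V \<in> B \<Longrightarrow> openin X V"
    "\<And>U x. openin X U \<Longrightarrow> x \<in> U \<Longrightarrow> \<exists>V\<in>B. x \<in> V \<and> V \<subseteq> U"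
    using assms(1) unfolding second_countable_def by metis
  have nb: "neighbourhood_base_of (\<lambda>U. closedin X U \<and> openin X U) X"
    using assms(2) by (simp add: dimension_le_0_neighbourhood_base_of_clopen)
  have cl: "\<exists>V. openin X V \<and> closedin X V \<and> x \<in> V \<and> V \<subseteq> U" if "openin X U" "x \<in> U" for U x
    using nb that unfolding neighbourhood_base_of by (meson subset_iff)
  define Q where "Q W W' V \<longleftrightarrow> openin X V \<and> closedin X V \<and> W \<subseteq> V \<and> V \<subseteq> W'" for W W' V
  define D where "D = {(W, W') \<in> B \<times> B. \<exists>V. Q W W' V}"
  define v where "v = (\<lambda>(W, W'). SOME V. Q W W' V)"
  have v: "Q W W' (v (W, W'))" if "(W, W') \<in> D" for W W'
    using that unfolding D_def v_def by (auto intro: someI)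
  show ?thesis
  proof (rule has_clopen_baseI[of "v ` D"])
    have "countable D"
      by (rule countable_subset[of _ "B \<times> B"]) (use B(1) in \<open>auto simp: D_def\<close>)
    then show "countable (v ` D)" by simp
    show "openin X V \<and> closedin X V" if "V \<in> v ` D" for V
      using that v unfolding Q_def by force
    fix U x assume U: "openin X U" "x \<in> U"
    obtain W' where W': "W' \<in> B" "x \<in> W'" "W' \<subseteq> U" using B(3)[OF U] by blast
    obtain V where V: "openin X V" "closedin X V" "x \<in> V" "V \<subseteq> W'"
      using cl[OF B(2)[OF W'(1)] W'(2)] by blast
    obtain W where W: "W \<in> B" "x \<in> W" "W \<subseteq> V" using B(3)[OF V(1,3)] by blast
    have "(W, W') \<in> D" using W' W V by (auto simp: D_def Q_def)
    then show "\<exists>V\<in>v ` D. x \<in> V \<and> V \<subseteq> U"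
      using v[of W W'] W W' unfolding Q_def by (intro bexI[of _ "v (W, W')"]) auto
  qed
qed

text \<open>The base consists of the cylinders given by finite lists of conditions. A general
  countable index type serves both Cantor space and the ambient space of
  \<open>Tr_space\<close>.\<close>

lemma has_clopen_base_cantor:
  "has_clopen_base (product_topology (\<lambda>_ :: 'i :: countable. discrete_topology (UNIV :: bool set)) UNIV)"
    (is "has_clopen_base ?X")
proof -
  define cyl where "cyl l = {f :: 'i \<Rightarrow> bool. \<forall>(i, b) \<in> set l. f i = b}" for l
  have clopen1: "openin ?X {f. f i = b} \<and> closedin ?X {f. f i = b}" for i b
  proof -
    have pr: "continuous_map ?X (discrete_topology UNIV) (\<lambda>f. f i)"
      by (rule continuous_map_product_projection) simp
    then show ?thesis
      using openin_continuous_map_preimage[OF pr, of "{b}"]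
        closedin_continuous_map_preimage[OF pr, of "{b}"] by (simp add: PiE_UNIV_domain)
  qed
  have clopen: "openin ?X (cyl l) \<and> closedin ?X (cyl l)" for l
  proof (induction l)
    case Nil
    have "cyl [] = topspace ?X" by (auto simp: cyl_def)
    then show ?case by (metis openin_topspace closedin_topspace)
  next
    case (Cons p l)
    have "cyl (p # l) = {f. f (fst p) = snd p} \<inter> cyl l" by (auto simp: cyl_def split_beta)
    then show ?case using Cons clopen1[of "fst p" "snd p"] by (metis closedin_Int openin_Int)
  qed
  show ?thesis
  proof (rule has_clopen_baseI[of "range cyl"])
    fix U x assume "openin ?X U" "x \<in> U"
    then obtain W where W: "finite {i. W i \<noteq> (UNIV :: bool set)}" "x \<in> Pi\<^sub>E UNIV W" "Pi\<^sub>E UNIV W \<subseteq> U"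
      unfolding openin_product_topology_alt by auto
    obtain l where l: "set l = {i. W i \<noteq> UNIV}" using finite_list[OF W(1)] by blast
    let ?l = "map (\<lambda>i. (i, x i)) l"
    have "y \<in> Pi\<^sub>E UNIV W" if "y \<in> cyl ?l" for y
    proof -
      have "y i \<in> W i" for i
        using that W(2) l by (cases "i \<in> set l") (auto simp: cyl_def PiE_UNIV_domain)
      then show ?thesis by (auto simp: PiE_UNIV_domain)
    qed
    moreover have "x \<in> cyl ?l" by (auto simp: cyl_def)
    ultimately show "\<exists>V\<in>range cyl. x \<in> V \<and> V \<subseteq> U" using W(3) by blast
  qed (use clopen in auto)
qed

lemma has_clopen_base_pullback:
  assumes "has_clopen_base X" "f ` A \<subseteq> topspace X"
  shows "has_clopen_base (pullback_topology A f X)"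
proof -
  let ?Y = "pullback_topology A f X"
  obtain C where C: "clopen_base X C"
    using assms(1) by (auto simp: has_clopen_base_def)
  let ?D = "\<lambda>n. f -` C n \<inter> A"
  have "openin ?Y (?D n) \<and> closedin ?Y (?D n)" for n
  proof -
    have top: "topspace ?Y = A"
      using assms(2) by (auto simp: topspace_pullback_topology)
    have "A - ?D n = f -` (topspace X - C n) \<inter> A" using assms(2) by auto
    moreover have "openin X (C n)" "openin X (topspace X - C n)"
      using C by (auto simp: clopen_base_def)
    ultimately show ?thesis
      unfolding closedin_def top openin_pullback_topology by blast
  qed
  moreover have "\<exists>n. x \<in> ?D n \<and> ?D n \<subseteq> U" if "openin ?Y U" "x \<in> U" for U x
  proof -
    obtain V where V: "openin X V" "U = f -` V \<inter> A"
      using \<open>openin ?Y U\<close> by (auto simp: openin_pullback_topology)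
    then obtain n where "f x \<in> C n" "C n \<subseteq> V"
      using C \<open>x \<in> U\<close> unfolding clopen_base_def by blast
    then show ?thesis using V \<open>x \<in> U\<close> by blast
  qed
  ultimately have "clopen_base ?Y ?D" by (simp add: clopen_base_def)
  then show ?thesis by (auto simp: has_clopen_base_def)
qed

lemma has_clopen_base_Tr_space: "has_clopen_base Tr_space"
  unfolding Tr_space_def
  by (intro has_clopen_base_pullback has_clopen_base_cantor) (simp add: PiE_UNIV_domain)

lemma open_eq_Union_clopen:
  assumes "has_clopen_base X" "openin X U"
  obtains C :: "nat \<Rightarrow> 'a set" where "\<And>n. openin X (C n) \<and> closedin X (C n)" "U = (\<Union>n. C n)"
proof -
  obtain C where C: "clopen_base X C"
    using assms(1) by (auto simp: has_clopen_base_def)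
  let ?C = "\<lambda>n. if C n \<subseteq> U then C n else {}"
  have "U = (\<Union>n. ?C n)"
  proof (intro subset_antisym subsetI)
    fix x assume "x \<in> U"
    then obtain n where "x \<in> C n" "C n \<subseteq> U"
      using C assms(2) unfolding clopen_base_def by blast
    then show "x \<in> (\<Union>n. ?C n)" by auto
  qed (auto split: if_splits)
  moreover have "openin X (?C n) \<and> closedin X (?C n)" for n
    using clopen_baseD[OF C] by (cases "C n \<subseteq> U") simp_all
  ultimately show thesis by (intro that[of ?C]) auto
qed


section \<open>Closure properties of the Borel classes\<close>

lemma Sigma0_subset_topspace: "Sigma0 X \<xi> A \<Longrightarrow> A \<subseteq> topspace X"
  by (induction rule: Sigma0.induct) (auto dest: openin_subset)

lemma Pi0_subset_topspace: "Pi0 X \<xi> A \<Longrightarrow> A \<subseteq> topspace X"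
  by (simp add: Pi0_def)

lemma Sigma0_pos: "Sigma0 X \<xi> A \<Longrightarrow> \<xi> \<noteq> 0"
  by (induction rule: Sigma0.induct) (auto simp: one_cord_def)

lemma Sigma0_1_iff: "Sigma0 X 1 A \<longleftrightarrow> openin X A"
  by (auto intro: open_set elim: Sigma0.cases)

lemma Sigma0_Compl_iff: "A \<subseteq> topspace X \<Longrightarrow> Sigma0 X \<xi> (topspace X - A) \<longleftrightarrow> Pi0 X \<xi> A"
  by (simp add: Pi0_def)

lemma Pi0_Compl_iff: "A \<subseteq> topspace X \<Longrightarrow> Pi0 X \<xi> (topspace X - A) \<longleftrightarrow> Sigma0 X \<xi> A"
  by (simp add: Pi0_def double_diff)

lemma Sigma0_Union_Pi0:
  assumes "1 < \<xi>" "\<And>n :: nat. \<exists>\<eta><\<xi>. Pi0 X \<eta> (A n)"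
  shows "Sigma0 X \<xi> (\<Union>n. A n)"
proof -
  obtain \<eta> where \<eta>: "\<And>n. \<eta> n < \<xi>" "\<And>n. Pi0 X (\<eta> n) (A n)"
    using assms(2) by metis
  have "\<eta> n \<noteq> 0" for n
    using \<eta>(2) Sigma0_pos unfolding Pi0_def by blast
  then show ?thesis
    using \<eta> by (intro countable_union[OF assms(1), of \<eta>]) (auto simp: Pi0_def cord_one_le_iff)
qed

lemma Sigma0_higherE:
  assumes "Sigma0 X \<xi> B" "1 < \<xi>"
  obtains A :: "nat \<Rightarrow> 'a set" where "B = (\<Union>n. A n)" "\<And>n. \<exists>\<eta><\<xi>. Pi0 X \<eta> (A n)"
  using assms(1)
proof cases
  case (countable_union \<eta> A)
  then show thesis by (intro that[of A]) (auto simp: Pi0_def)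
qed (use assms(2) in auto)

lemma Pi0_imp_Sigma0:
  assumes "Pi0 X \<eta> A" "\<eta> < \<xi>" shows "Sigma0 X \<xi> A"
proof -
  have "1 < \<xi>"
    using assms Sigma0_pos by (metis Pi0_def cord_one_le_iff le_less_trans)
  then show ?thesis using Sigma0_Union_Pi0[of \<xi> X "\<lambda>_. A"] assms by auto
qed

lemma Sigma0_imp_Pi0:
  assumes "Sigma0 X \<eta> A" "\<eta> < \<xi>" shows "Pi0 X \<xi> A"
proof -
  have A: "A \<subseteq> topspace X" using assms(1) by (rule Sigma0_subset_topspace)
  then have "Pi0 X \<eta> (topspace X - A)" using assms(1) by (simp add: Pi0_Compl_iff)
  then have "Sigma0 X \<xi> (topspace X - A)" using assms(2) by (rule Pi0_imp_Sigma0)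
  then show ?thesis using A by (simp add: Pi0_def)
qed

lemma Pi0_higherE:
  assumes "Pi0 X \<xi> B" "1 < \<xi>"
  obtains A :: "nat \<Rightarrow> 'a set" where "B = (\<Inter>n. A n)" "\<And>n. \<exists>\<eta><\<xi>. Sigma0 X \<eta> (A n)"
proof -
  obtain A :: "nat \<Rightarrow> 'a set" where A: "topspace X - B = (\<Union>n. A n)" "\<And>n. \<exists>\<eta><\<xi>. Pi0 X \<eta> (A n)"
    using assms Sigma0_higherE[of X \<xi> "topspace X - B"] by (metis Pi0_def)
  have "B = topspace X - (\<Union>n. A n)"
    using A(1) assms(1) by (metis Pi0_def double_diff order_refl)
  then have "B = (\<Inter>n. topspace X - A n)" by auto
  moreover have "\<exists>\<eta><\<xi>. Sigma0 X \<eta> (topspace X - A n)" for n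
    using A(2)[of n] by (auto simp: Pi0_def)
  ultimately show thesis by (rule that)
qed

lemma Sigma0_continuous_preimage:
  assumes f: "continuous_map X Y f" and "Sigma0 Y \<xi> B"
  shows "Sigma0 X \<xi> {x \<in> topspace X. f x \<in> B}"
  using assms(2)
proof induction
  case (open_set U)
  then show ?case using f by (simp add: Sigma0.open_set openin_continuous_map_preimage)
next
  case (countable_union \<xi> \<eta> A)
  let ?P = "\<lambda>B. {x \<in> topspace X. f x \<in> B}"
  have Diff: "topspace X - ?P (A n) = ?P (topspace Y - A n)" for n
    using f by (auto simp: continuous_map_def)
  have "Sigma0 X \<xi> (\<Union>n. ?P (A n))"
  proof (rule Sigma0.countable_union[OF countable_union(1)])
    show "1 \<le> \<eta> n \<and> \<eta> n < \<xi> \<and> ?P (A n) \<subseteq> topspace X \<and> Sigma0 X (\<eta> n) (topspace X - ?P (A n))"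
      for n unfolding Diff using countable_union(2)[of n] by auto
  qed
  moreover have "(\<Union>n. ?P (A n)) = ?P (\<Union>n. A n)" by auto
  ultimately show ?case by metis
qed

lemma Pi0_continuous_preimage:
  assumes "continuous_map X Y f" "Pi0 Y \<xi> B"
  shows "Pi0 X \<xi> {x \<in> topspace X. f x \<in> B}"
proof -
  have "topspace X - {x \<in> topspace X. f x \<in> B} = {x \<in> topspace X. f x \<in> topspace Y - B}"
    using assms(1) by (auto simp: continuous_map_def)
  then show ?thesis
    using Sigma0_continuous_preimage[OF assms(1), of \<xi> "topspace Y - B"] assms(2)
    by (simp add: Pi0_def)
qed

section \<open>Borel classes over a clopen base\<close>

context
  fixes X :: "'a topology"
  assumes base: "has_clopen_base X"
begin

text \<open>Only \<open>\<eta> = 1\<close> needs the base: an open set is a countable union of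
  clopen sets, which are \<open>Pi0\<close> of index 1. Above 1 the same union serves for both
  indices.\<close>

lemma Sigma0_mono:
  assumes "Sigma0 X \<eta> A" "\<eta> \<le> \<xi>"
  shows "Sigma0 X \<xi> A"
proof (cases "\<eta> = \<xi>")
  case False
  with assms(2) have lt: "\<eta> < \<xi>" by simp
  have \<xi>: "1 < \<xi>"
    using Sigma0_pos[OF assms(1)] lt by (metis cord_one_le_iff le_less_trans)
  show ?thesis
  proof (cases "\<eta> = 1")
    case True
    then have "openin X A" using assms(1) by (simp add: Sigma0_1_iff)
    then obtain C :: "nat \<Rightarrow> 'a set"
      where C: "\<And>n. openin X (C n) \<and> closedin X (C n)" "A = (\<Union>n. C n)"
      using open_eq_Union_clopen[OF base] by metis
    have "Pi0 X 1 (C n)" for n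
      using C(1)[of n] by (auto simp: Pi0_def Sigma0_1_iff closedin_def)
    then show ?thesis unfolding C(2) using \<xi> by (intro Sigma0_Union_Pi0) auto
  next
    case False
    with Sigma0_pos[OF assms(1)] have "1 < \<eta>" by (metis cord_one_le_iff le_less)
    then obtain B :: "nat \<Rightarrow> 'a set" where "A = (\<Union>n. B n)" "\<And>n. \<exists>\<theta><\<eta>. Pi0 X \<theta> (B n)"
      using Sigma0_higherE[OF assms(1)] by metis
    then show ?thesis using \<xi> lt Sigma0_Union_Pi0[of \<xi> X B] less_trans by blast
  qed
qed (use assms in simp)

lemma Pi0_mono: "Pi0 X \<eta> A \<Longrightarrow> \<eta> \<le> \<xi> \<Longrightarrow> Pi0 X \<xi> A"
  using Sigma0_mono by (auto simp: Pi0_def)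

lemma Sigma0_UN_nat:
  assumes A: "\<And>n :: nat. Sigma0 X \<xi> (A n)"
  shows "Sigma0 X \<xi> (\<Union>n. A n)"
proof (cases "\<xi> = 1")
  case True
  then show ?thesis using A by (auto simp: Sigma0_1_iff)
next
  case False
  with Sigma0_pos[OF A] have \<xi>: "1 < \<xi>" by (metis cord_one_le_iff le_less)
  then have "\<exists>B :: nat \<Rightarrow> 'a set. A n = (\<Union>m. B m) \<and> (\<forall>m. \<exists>\<eta><\<xi>. Pi0 X \<eta> (B m))" for n
    using Sigma0_higherE[OF A[of n]] by metis
  then obtain B :: "nat \<Rightarrow> nat \<Rightarrow> 'a set"
    where B: "\<And>n. A n = (\<Union>m. B n m)" "\<And>n m. \<exists>\<eta><\<xi>. Pi0 X \<eta> (B n m)" by metis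
  have "(\<Union>k. case prod_decode k of (n, m) \<Rightarrow> B n m) = (\<Union>n. \<Union>m. B n m)" (is "?L = ?R")
  proof (intro subset_antisym subsetI)
    fix x assume "x \<in> ?R"
    then obtain n m where "x \<in> B n m" by blast
    then have "x \<in> (case prod_decode (prod_encode (n, m)) of (n, m) \<Rightarrow> B n m)" by simp
    then show "x \<in> ?L" by (rule UN_I[OF UNIV_I])
  next
    fix x assume "x \<in> ?L"
    then obtain k where "x \<in> (case prod_decode k of (n, m) \<Rightarrow> B n m)" by (rule UN_E)
    then show "x \<in> ?R" by (cases "prod_decode k") auto
  qed
  moreover have "Sigma0 X \<xi> ?L"
    using \<xi> by (rule Sigma0_Union_Pi0) (auto simp: B(2) split: prod.split)
  ultimately show ?thesis using B(1) by simp
qed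

lemma Sigma0_empty: "\<xi> \<noteq> 0 \<Longrightarrow> Sigma0 X \<xi> {}"
  using Sigma0_mono[of 1 "{}" \<xi>] by (simp add: Sigma0_1_iff cord_one_le_iff)

lemma Sigma0_topspace: "\<xi> \<noteq> 0 \<Longrightarrow> Sigma0 X \<xi> (topspace X)"
  using Sigma0_mono[of 1 "topspace X" \<xi>] by (simp add: Sigma0_1_iff cord_one_le_iff)

lemma Sigma0_UN:
  assumes "countable I" "\<xi> \<noteq> 0" "\<And>i. i \<in> I \<Longrightarrow> Sigma0 X \<xi> (A i)"
  shows "Sigma0 X \<xi> (\<Union>i\<in>I. A i)"
proof (cases "I = {}")
  case False
  have "Sigma0 X \<xi> (\<Union>n. A (from_nat_into I n))"
    by (intro Sigma0_UN_nat assms(3) from_nat_into False)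
  moreover have "(\<Union>n. A (from_nat_into I n)) = (\<Union>i\<in>range (from_nat_into I). A i)"
    by simp
  ultimately show ?thesis
    by (simp only: range_from_nat_into[OF False assms(1)])
qed (use assms Sigma0_empty in simp)

lemma Sigma0_Un:
  assumes "Sigma0 X \<xi> A" "Sigma0 X \<xi> B" shows "Sigma0 X \<xi> (A \<union> B)"
  using Sigma0_UN[of "{A, B}" \<xi> id] assms Sigma0_pos[OF assms(1)] by auto

lemma Pi0_INT:
  assumes "countable I" "I \<noteq> {}" "\<And>i. i \<in> I \<Longrightarrow> Pi0 X \<xi> (A i)"
  shows "Pi0 X \<xi> (\<Inter>i\<in>I. A i)"
proof -
  have "\<xi> \<noteq> 0" using assms Sigma0_pos unfolding Pi0_def by (metis equals0I)
  moreover have "topspace X - (\<Inter>i\<in>I. A i) = (\<Union>i\<in>I. topspace X - A i)" by auto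
  ultimately show ?thesis
    using assms Sigma0_UN[OF assms(1), of \<xi> "\<lambda>i. topspace X - A i"]
    unfolding Pi0_def by auto
qed

lemma Pi0_Int:
  assumes "Pi0 X \<xi> A" "Pi0 X \<xi> B" shows "Pi0 X \<xi> (A \<inter> B)"
  using Pi0_INT[of "{A, B}" \<xi> id] assms by auto

text \<open>Union distributes over the two countable intersections, and each
  \<open>A' n \<union> B' m\<close> is \<open>Sigma0\<close> at the larger of two indices below
  \<open>\<xi>\<close>.\<close>

lemma Pi0_Un:
  assumes "Pi0 X \<xi> A" "Pi0 X \<xi> B" shows "Pi0 X \<xi> (A \<union> B)"
proof (cases "\<xi> = 1")
  case True
  with assms have "closedin X A" "closedin X B"
    by (auto simp: Pi0_def Sigma0_1_iff closedin_def)
  then have "closedin X (A \<union> B)" by auto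
  with True show ?thesis by (simp add: Pi0_def Sigma0_1_iff closedin_def)
next
  case False
  with Sigma0_pos assms have \<xi>: "1 < \<xi>" by (metis Pi0_def cord_one_le_iff le_less)
  obtain A' :: "nat \<Rightarrow> 'a set" where A': "A = (\<Inter>n. A' n)" "\<And>n. \<exists>\<eta><\<xi>. Sigma0 X \<eta> (A' n)"
    using Pi0_higherE[OF assms(1) \<xi>] by metis
  obtain B' :: "nat \<Rightarrow> 'a set" where B': "B = (\<Inter>n. B' n)" "\<And>n. \<exists>\<eta><\<xi>. Sigma0 X \<eta> (B' n)"
    using Pi0_higherE[OF assms(2) \<xi>] by metis
  have "Pi0 X \<xi> (A' n \<union> B' m)" for n m
  proof -
    obtain \<eta> \<theta> where h: "\<eta> < \<xi>" "Sigma0 X \<eta> (A' n)" "\<theta> < \<xi>" "Sigma0 X \<theta> (B' m)"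
      using A'(2)[of n] B'(2)[of m] by blast
    then have "Sigma0 X (max \<eta> \<theta>) (A' n \<union> B' m)"
      by (intro Sigma0_Un) (auto intro: Sigma0_mono)
    then show ?thesis by (rule Sigma0_imp_Pi0) (use h in simp)
  qed
  then have "Pi0 X \<xi> (\<Inter>n. \<Inter>m. A' n \<union> B' m)"
    by (intro Pi0_INT) auto
  moreover have "A \<union> B = (\<Inter>n. \<Inter>m. A' n \<union> B' m)" unfolding A'(1) B'(1) by auto
  ultimately show ?thesis by simp
qed

lemma Sigma0_Int:
  assumes "Sigma0 X \<xi> A" "Sigma0 X \<xi> B" shows "Sigma0 X \<xi> (A \<inter> B)"
proof -
  have s: "A \<subseteq> topspace X" "B \<subseteq> topspace X" using assms Sigma0_subset_topspace by auto
  then have "Pi0 X \<xi> ((topspace X - A) \<union> (topspace X - B))"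
    using assms by (intro Pi0_Un) (simp_all add: Pi0_Compl_iff)
  moreover have "(topspace X - A) \<union> (topspace X - B) = topspace X - A \<inter> B" by auto
  ultimately show ?thesis using s by (metis Pi0_Compl_iff le_infI1)
qed

lemma Delta0_osuc:
  assumes "Pi0 X \<xi> A" shows "Delta0 X (osuc \<xi>) A"
  using Pi0_imp_Sigma0[OF assms, of "osuc \<xi>"] Pi0_mono[OF assms, of "osuc \<xi>"]
  by (simp add: Delta0_def less_imp_le)

lemma Delta0_Diff:
  assumes "Delta0 X \<xi> A" "Delta0 X \<xi> B" shows "Delta0 X \<xi> (A - B)"
proof -
  have s: "A \<subseteq> topspace X" "B \<subseteq> topspace X"
    using assms by (auto simp: Delta0_def Pi0_def)
  then have "A - B = A \<inter> (topspace X - B)" by auto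
  with s assms show ?thesis
    using Sigma0_Int[of \<xi> A "topspace X - B"] Pi0_Int[of \<xi> A "topspace X - B"]
    by (simp add: Delta0_def Sigma0_Compl_iff Pi0_Compl_iff)
qed

end


section \<open>A set in \<open>\<Pi>\<close> but not in \<open>\<Sigma>\<close>\<close>

abbreviation cantor :: "(nat \<Rightarrow> bool) topology" where
  "cantor \<equiv> product_topology (\<lambda>_. discrete_topology UNIV) UNIV"

lemma topspace_cantor [simp]: "topspace cantor = UNIV"
  by (simp add: PiE_UNIV_domain)

lemma continuous_map_cantor_iff:
  "continuous_map X cantor f \<longleftrightarrow> (\<forall>i. continuous_map X (discrete_topology UNIV) (\<lambda>x. f x i))"
  by (simp add: continuous_map_componentwise_UNIV)

text \<open>\<open>U\<close> is a universal \<open>\<Sigma>\<close> set, given by its sections; its membership relation is only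
  used along the graph of a continuous \<open>h\<close>, which avoids products of spaces.\<close>

lemma universal_Sigma0:
  assumes "\<xi> \<noteq> 0"
  shows "\<exists>U. (\<forall>A. Sigma0 cantor \<xi> A \<longrightarrow> (\<exists>c :: nat \<Rightarrow> bool. U c = A)) \<and>
    (\<forall>h. continuous_map cantor cantor h \<longrightarrow> Sigma0 cantor \<xi> {x. x \<in> U (h x)})"
  using assms
proof (induction \<xi> rule: less_induct)
  case (less \<xi>)
  have base: "has_clopen_base cantor" by (rule has_clopen_base_cantor)
  show ?case
  proof (cases "\<xi> = 1")
    case True
    obtain C where C: "clopen_base cantor C" using base by (auto simp: has_clopen_base_def)
    define U where "U c = (\<Union>n\<in>{n. c n}. C n)" for c
    have "\<exists>c. U c = A" if "openin cantor A" for A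
    proof
      \<comment> \<open>The code of an open set selects all basic sets inside it.\<close>
      show "U (\<lambda>n. C n \<subseteq> A) = A"
        using C that unfolding clopen_base_def U_def by blast
    qed
    moreover have "openin cantor {x. x \<in> U (h x)}" if h: "continuous_map cantor cantor h" for h
    proof -
      have "openin cantor {x \<in> topspace cantor. h x n \<in> {True}}" for n
        by (rule openin_continuous_map_preimage) (use h in \<open>auto simp: continuous_map_cantor_iff\<close>)
      then have "openin cantor (\<Union>n. C n \<inter> {x. h x n})"
        using clopen_baseD[OF C] by (intro openin_Union) (auto intro!: openin_Int)
      moreover have "{x. x \<in> U (h x)} = (\<Union>n. C n \<inter> {x. h x n})" by (auto simp: U_def)
      ultimately show ?thesis by simp
    qed
    ultimately show ?thesis unfolding True Sigma0_1_iff by blast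
  next
    case False
    with less.prems have \<xi>: "1 < \<xi>" by (metis cord_one_le_iff le_less)
    define E where "E = {\<eta>. \<eta> \<noteq> 0 \<and> \<eta> < \<xi>}"
    have E: "countable E" "E \<noteq> {}"
      using \<xi> countable_subset[OF _ countable_lessThan_cord[of \<xi>], of E]
      by (auto simp: E_def one_cord_def intro!: exI[of _ 1])
    define e where "e = from_nat_into E"
    have e: "e m \<in> E" for m unfolding e_def by (rule from_nat_into[OF E(2)])
    have e_surj: "\<exists>m. e m = \<eta>" if "\<eta> \<in> E" for \<eta>
      unfolding e_def using from_nat_into_surj[OF E(1) that] by blast
    define Q where "Q \<eta> U \<longleftrightarrow> (\<forall>A. Sigma0 cantor \<eta> A \<longrightarrow> (\<exists>c :: nat \<Rightarrow> bool. U c = A)) \<and>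
      (\<forall>h. continuous_map cantor cantor h \<longrightarrow> Sigma0 cantor \<eta> {x. x \<in> U (h x)})" for \<eta> U
    have "\<forall>\<eta>\<in>E. \<exists>U. Q \<eta> U"
      using less.IH unfolding E_def Q_def by simp
    then obtain V where V: "\<And>\<eta>. \<eta> \<in> E \<Longrightarrow> Q \<eta> (V \<eta>)" by metis
    have V1: "\<exists>c :: nat \<Rightarrow> bool. V \<eta> c = A" if "\<eta> \<in> E" "Sigma0 cantor \<eta> A" for \<eta> A
      using V[OF that(1)] that(2) unfolding Q_def by simp
    have V2: "Sigma0 cantor \<eta> {x. x \<in> V \<eta> (h x)}"
      if "\<eta> \<in> E" "continuous_map cantor cantor h" for \<eta> h
      using V[OF that(1)] that(2) unfolding Q_def by simp
    \<comment> \<open>A single code is split into a double sequence of codes: \<open>p m n c\<close>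
      describes the complement of the \<open>n\<close>-th set, provided its index is
      \<open>e m\<close>.\<close>
    define p where "p m n c = (\<lambda>i. c (prod_encode (prod_encode (m, n), i)))"
      for m n :: nat and c :: "nat \<Rightarrow> bool"
    define U where "U c = (\<Union>m. \<Union>n. - V (e m) (p m n c))" for c
    have "\<exists>c. U c = A" if A: "Sigma0 cantor \<xi> A" for A
    proof -
      obtain B :: "nat \<Rightarrow> (nat \<Rightarrow> bool) set"
        where B: "A = (\<Union>n. B n)" "\<And>n. \<exists>\<eta><\<xi>. Pi0 cantor \<eta> (B n)"
        using Sigma0_higherE[OF A \<xi>] by metis
      then obtain \<eta> where \<eta>: "\<And>n. \<eta> n < \<xi>" "\<And>n. Sigma0 cantor (\<eta> n) (- B n)"
        by (metis Compl_eq_Diff_UNIV Pi0_def topspace_cantor)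
      \<comment> \<open>Where \<open>e m\<close> is not the index of \<open>B n\<close>, the code of
        the whole space is used, so that the complement taken in \<open>U\<close> adds
        nothing.\<close>
      have "\<exists>c. V (e m) c = (if e m = \<eta> n then - B n else UNIV)" for m n
        using V1[OF e[of m], of "- B n"] V1[OF e[of m], of UNIV] \<eta>(2)[of n] e[of m]
          Sigma0_topspace[OF base, of "e m"] by (auto simp: E_def)
      then obtain c where c: "\<And>m n. V (e m) (c m n) = (if e m = \<eta> n then - B n else UNIV)"
        by metis
      define d where "d k = (case prod_decode k of (mn, i) \<Rightarrow>
        case prod_decode mn of (m, n) \<Rightarrow> c m n i)" for k
      have pd: "p m n d = c m n" for m n by (simp add: p_def d_def)
      have "\<exists>m. e m = \<eta> n" for n
        using e_surj[of "\<eta> n"] \<eta> Sigma0_pos unfolding E_def by blast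
      then have "x \<in> U d \<longleftrightarrow> x \<in> A" for x
        unfolding B(1) U_def pd c by (auto split: if_splits) metis
      then have "U d = A" by blast
      then show ?thesis by blast
    qed
    moreover have "Sigma0 cantor \<xi> {x. x \<in> U (h x)}" if h: "continuous_map cantor cantor h" for h
    proof -
      have "Sigma0 cantor \<xi> {x. x \<notin> V (e m) (p m n (h x))}" for m n
      proof -
        have "continuous_map cantor cantor (\<lambda>x. p m n (h x))"
          using h unfolding continuous_map_cantor_iff by (simp add: p_def)
        then have "Sigma0 cantor (e m) {x. x \<in> V (e m) (p m n (h x))}"
          by (rule V2[OF e])
        then have "Pi0 cantor (e m) {x. x \<notin> V (e m) (p m n (h x))}"
          by (simp add: Pi0_def Diff_eq Collect_neg_eq[symmetric])
        then show ?thesis by (rule Pi0_imp_Sigma0) (use e[of m] in \<open>simp add: E_def\<close>)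
      qed
      then have "Sigma0 cantor \<xi> (\<Union>m. \<Union>n. {x. x \<notin> V (e m) (p m n (h x))})"
        by (intro Sigma0_UN_nat[OF base])
      moreover have "{x. x \<in> U (h x)} = (\<Union>m. \<Union>n. {x. x \<notin> V (e m) (p m n (h x))})"
        by (auto simp: U_def)
      ultimately show ?thesis by simp
    qed
    ultimately show ?thesis by blast
  qed
qed

text \<open>Cantor's diagonal argument: take the identity for \<open>h\<close>. A code
  \<open>c\<close> of \<open>{x. x \<notin> U x}\<close> would satisfy \<open>c \<in> U c\<close>
  iff \<open>c \<notin> U c\<close>.\<close>

lemma Pi0_not_Sigma0:
  assumes "\<xi> \<noteq> 0"
  shows "\<exists>A. Pi0 cantor \<xi> A \<and> \<not> Sigma0 cantor \<xi> A"
proof -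
  obtain U where U: "\<And>A. Sigma0 cantor \<xi> A \<Longrightarrow> \<exists>c :: nat \<Rightarrow> bool. U c = A"
    "\<And>h. continuous_map cantor cantor h \<Longrightarrow> Sigma0 cantor \<xi> {x. x \<in> U (h x)}"
    using universal_Sigma0[OF assms] by blast
  have "Sigma0 cantor \<xi> {x. x \<in> U x}" by (rule U(2)) simp
  then have "Pi0 cantor \<xi> {x. x \<notin> U x}"
    by (simp add: Pi0_def Diff_eq Collect_neg_eq[symmetric])
  moreover have "\<not> Sigma0 cantor \<xi> {x. x \<notin> U x}"
    using U(1)[of "{x. x \<notin> U x}"] by (metis mem_Collect_eq)
  ultimately show ?thesis by blast
qed


section \<open>Ranks of trees\<close>

definition prefix_closed :: "nat list set \<Rightarrow> bool" where
  "prefix_closed T \<longleftrightarrow> (\<forall>s t. s @ t \<in> T \<longrightarrow> s \<in> T)"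

definition subtree :: "nat list \<Rightarrow> nat list set \<Rightarrow> nat list set" where
  "subtree s T = {t. s @ t \<in> T}"

text \<open>\<open>tall \<beta> T\<close> says that the root of \<open>T\<close> has rank at least \<open>\<beta>\<close>, where a node on an infinite
  branch has rank \<open>\<infinity>\<close>; accordingly, \<open>ill\<close> means ill-founded.\<close>

function tall :: "cord \<Rightarrow> nat list set \<Rightarrow> bool" where
  "tall \<beta> T \<longleftrightarrow> [] \<in> T \<and> (\<forall>\<gamma><\<beta>. \<exists>n. tall \<gamma> (subtree [n] T))"
  by auto
termination
  by (relation "inv_image {(x, y). x < y} fst") (auto intro: wf)

declare tall.simps [simp del]

definition ill :: "nat list set \<Rightarrow> bool" where
  "ill T \<longleftrightarrow> (\<forall>\<beta>. tall \<beta> T)"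

text \<open>No node has its rank in the interval from \<open>\<beta>\<close> to \<open>\<infinity>\<close>, \<open>\<infinity>\<close> excluded.\<close>

definition gap :: "cord \<Rightarrow> nat list set \<Rightarrow> bool" where
  "gap \<beta> T \<longleftrightarrow> (\<forall>s. tall \<beta> (subtree s T) \<longrightarrow> ill (subtree s T))"

lemma Tr_iff: "T \<in> Tr \<longleftrightarrow> [] \<in> T \<and> prefix_closed T"
  by (auto simp: Tr_def prefix_closed_def prefix_def)

lemma subtree_Nil [simp]: "subtree [] T = T"
  by (simp add: subtree_def)

lemma subtree_subtree [simp]: "subtree s (subtree t T) = subtree (t @ s) T"
  by (simp add: subtree_def)

lemma subtree_UNIV [simp]: "subtree s UNIV = UNIV"
  by (simp add: subtree_def)

lemma prefix_closed_subtree: "prefix_closed T \<Longrightarrow> prefix_closed (subtree s T)"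
  unfolding prefix_closed_def subtree_def by (metis append_assoc mem_Collect_eq)

lemma prefix_closed_empty [simp]: "prefix_closed {}"
  and prefix_closed_UNIV [simp]: "prefix_closed UNIV"
  by (auto simp: prefix_closed_def)

lemma tall_root: "tall \<beta> T \<Longrightarrow> [] \<in> T"
  by (simp add: tall.simps[of \<beta>])

lemma not_tall_empty [simp]: "\<not> tall \<beta> {}"
  using tall_root by blast

lemma tall_antimono: "tall \<beta> T \<Longrightarrow> \<gamma> \<le> \<beta> \<Longrightarrow> tall \<gamma> T"
  by (subst (asm) tall.simps, subst tall.simps) (auto intro: less_le_trans)

lemma tall_osuc: "tall (osuc \<beta>) T \<longleftrightarrow> [] \<in> T \<and> (\<exists>n. tall \<beta> (subtree [n] T))"
  by (subst tall.simps) (use tall_antimono in \<open>auto; blast\<close>)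

text \<open>For \<open>\<gamma> < \<beta>\<close> also \<open>osuc \<gamma> < \<beta>\<close>, which
  supplies the child of rank at least \<open>\<gamma>\<close>. This matches the intersection taken
  by the Lusin derivative at limits.\<close>

lemma tall_olimit: "olimit \<beta> \<Longrightarrow> tall \<beta> T \<longleftrightarrow> (\<forall>\<gamma><\<beta>. tall \<gamma> T)"
proof (intro iffI)
  assume \<beta>: "olimit \<beta>" and *: "\<forall>\<gamma><\<beta>. tall \<gamma> T"
  have "tall 0 T" using * \<beta> by (metis cord_pos_iff not_olimit_0)
  then have "[] \<in> T" by (rule tall_root)
  moreover have "\<exists>n. tall \<gamma> (subtree [n] T)" if "\<gamma> < \<beta>" for \<gamma>
    using * olimit_osuc_less[OF \<beta> that] by (auto simp: tall_osuc)
  ultimately show "tall \<beta> T" by (subst tall.simps) blast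
qed (auto intro: tall_antimono)

lemma tall_subtree:
  assumes "prefix_closed T" "tall \<beta> (subtree s T)"
  shows "tall \<beta> T"
  using assms
proof (induction s arbitrary: T)
  case (Cons n s)
  from Cons.prems(2) have "tall \<beta> (subtree s (subtree [n] T))" by simp
  then have "tall \<beta> (subtree [n] T)"
    by (rule Cons.IH[OF prefix_closed_subtree[OF Cons.prems(1)]])
  moreover have "[] \<in> T"
    using tall_root[OF Cons.prems(2)] Cons.prems(1) unfolding prefix_closed_def subtree_def
    by (metis append_Nil mem_Collect_eq)
  ultimately have "tall (osuc \<beta>) T" by (auto simp: tall_osuc)
  then show ?case by (rule tall_antimono) (simp add: less_imp_le)
qed simp

lemma illD: "ill T \<Longrightarrow> tall \<beta> T"
  by (simp add: ill_def)

lemma not_ill_empty [simp]: "\<not> ill {}"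
  by (simp add: ill_def)

lemma ill_UNIV [simp]: "ill UNIV"
proof -
  have "tall \<beta> UNIV" for \<beta>
    by (induction \<beta> rule: less_induct) (subst tall.simps, simp)
  then show ?thesis by (simp add: ill_def)
qed

lemma ill_parent: "[] \<in> T \<Longrightarrow> ill (subtree [n] T) \<Longrightarrow> ill T"
  unfolding ill_def by (subst tall.simps) blast

text \<open>If every child had a bounded rank, the countably many bounds would lie below one
  countable ordinal \<open>b\<close>, contradicting that the root has rank at least
  \<open>osuc b\<close>.\<close>

lemma ill_child:
  assumes "ill T" shows "\<exists>n. ill (subtree [n] T)"
proof (rule ccontr)
  assume "\<not> ?thesis"
  then obtain \<beta> where \<beta>: "\<And>n. \<not> tall (\<beta> n) (subtree [n] T)" unfolding ill_def by metis
  obtain b where "\<And>n. \<beta> n < b" using countable_bounded_cord[of "range \<beta>"] by auto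
  moreover have "tall (osuc b) T" using assms by (rule illD)
  ultimately show False
    using \<beta> tall_antimono by (metis less_imp_le tall_osuc)
qed

lemma gap_iff: "gap \<beta> T \<longleftrightarrow> (tall \<beta> T \<longrightarrow> ill T) \<and> (\<forall>n. gap \<beta> (subtree [n] T))"
proof
  show "gap \<beta> T \<Longrightarrow> (tall \<beta> T \<longrightarrow> ill T) \<and> (\<forall>n. gap \<beta> (subtree [n] T))"
    unfolding gap_def by (metis subtree_Nil subtree_subtree)
  assume R: "(tall \<beta> T \<longrightarrow> ill T) \<and> (\<forall>n. gap \<beta> (subtree [n] T))"
  show "gap \<beta> T"
    unfolding gap_def
  proof (intro allI)
    fix s show "tall \<beta> (subtree s T) \<longrightarrow> ill (subtree s T)"
    proof (cases s)
      case (Cons n t)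
      then have "subtree s T = subtree t (subtree [n] T)" by simp
      with R show ?thesis unfolding gap_def by metis
    qed (use R in simp)
  qed
qed

lemma gapD: "gap \<beta> T \<Longrightarrow> tall \<beta> T \<Longrightarrow> ill T"
  by (simp add: gap_iff[of \<beta> T])

lemma gap_subtree: "gap \<beta> T \<Longrightarrow> gap \<beta> (subtree s T)"
  by (simp add: gap_def)

lemma gap_mono: "gap \<beta> T \<Longrightarrow> \<beta> \<le> \<gamma> \<Longrightarrow> gap \<gamma> T"
  unfolding gap_def using tall_antimono by blast

text \<open>No node has larger rank than the root, so the condition in \<open>gap\<close> is
  vacuous.\<close>

lemma gap_not_tall: "prefix_closed T \<Longrightarrow> \<not> tall \<beta> T \<Longrightarrow> gap \<beta> T"
  unfolding gap_def using tall_subtree by blast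

lemma gap_empty [simp]: "gap \<beta> {}"
  by (rule gap_not_tall) simp_all

lemma gap_UNIV [simp]: "gap \<beta> UNIV"
  by (simp add: gap_def)


section \<open>The Lusin height\<close>

text \<open>Each derivative step removes the leaves, so a node survives \<open>\<beta>\<close> steps
  iff its rank is at least \<open>\<beta>\<close>. The root is excluded because
  \<open>lusin_deriv\<close> always keeps it.\<close>

lemma lusin_iter_iff_tall:
  assumes "T \<in> Tr" "s \<noteq> []"
  shows "s \<in> lusin_iter \<beta> T \<longleftrightarrow> tall \<beta> (subtree s T)"
  using assms(2)
proof (induction \<beta> arbitrary: s rule: cord_induct)
  case zero
  show ?case by (subst tall.simps) (simp add: subtree_def)
next
  case (osuc \<beta>)
  have "s \<in> T" if "tall \<beta> (subtree (s @ [n]) T)" for n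
    using tall_root[OF that] assms(1) by (auto simp: Tr_iff prefix_closed_def subtree_def)
  then show ?case
    using osuc by (auto simp: tall_osuc lusin_deriv_def subtree_def)
next
  case (olimit \<beta>)
  then show ?case by (auto simp: lusin_iter_olimit tall_olimit)
qed

text \<open>The iterates are constant from the height on, so the height is at most
  \<open>\<beta>\<close> iff step \<open>\<beta>\<close> removes nothing, that is, iff no node other
  than the root has rank exactly \<open>\<beta>\<close>.\<close>

lemma lusin_height_le_iff:
  assumes T: "T \<in> Tr"
  shows "lusin_height T \<le> \<beta> \<longleftrightarrow>
    (\<forall>s. s \<noteq> [] \<longrightarrow> tall \<beta> (subtree s T) \<longrightarrow> tall (osuc \<beta>) (subtree s T))"
proof -
  have "lusin_height T \<le> \<beta> \<longleftrightarrow> lusin_iter (osuc \<beta>) T = lusin_iter \<beta> T"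
  proof
    assume "lusin_iter (osuc \<beta>) T = lusin_iter \<beta> T"
    then show "lusin_height T \<le> \<beta>"
      unfolding lusin_height_def by (intro Least_le) (simp add: cord_add_1)
  next
    let ?h = "lusin_height T"
    have fix_deriv: "lusin_deriv (lusin_iter ?h T) = lusin_iter ?h T"
      using lusin_height_attained[OF T] by (simp add: cord_add_1)
    have const: "lusin_iter \<gamma> T = lusin_iter ?h T" if "?h \<le> \<gamma>" for \<gamma>
      using that
    proof (induction \<gamma> rule: cord_induct)
      case zero
      then show ?case by (metis order_antisym zero_le_cord)
    next
      case (osuc \<gamma>)
      show ?case
      proof (cases "?h = osuc \<gamma>")
        case False
        with osuc.prems have "?h \<le> \<gamma>" by (simp add: le_less)
        with osuc.IH fix_deriv show ?thesis by simp
      qed simp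
    next
      case (olimit \<gamma>)
      show ?case
      proof (cases "?h = \<gamma>")
        case False
        with olimit.prems have "?h < \<gamma>" by simp
        moreover have "lusin_iter ?h T \<subseteq> lusin_iter \<xi> T" if "\<xi> < \<gamma>" for \<xi>
          using lusin_iter_antimono[OF T, of \<xi> ?h] olimit.IH[OF that] by (metis linear order_refl)
        ultimately show ?thesis by (auto simp: lusin_iter_olimit[OF olimit(1)])
      qed simp
    qed
    assume "?h \<le> \<beta>"
    moreover then have "?h \<le> osuc \<beta>" by (metis less_imp_le less_osuc_iff)
    ultimately show "lusin_iter (osuc \<beta>) T = lusin_iter \<beta> T" using const by metis
  qed
  also have "\<dots> \<longleftrightarrow> lusin_iter \<beta> T \<subseteq> lusin_iter (osuc \<beta>) T"
    using lusin_iter_antimono[OF T, of \<beta> "osuc \<beta>"] by (auto simp: less_imp_le)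
  also have "\<dots> \<longleftrightarrow> (\<forall>s. s \<noteq> [] \<longrightarrow> s \<in> lusin_iter \<beta> T \<longrightarrow> s \<in> lusin_iter (osuc \<beta>) T)"
    by (auto simp: lusin_deriv_def)
  also have "\<dots> \<longleftrightarrow> (\<forall>s. s \<noteq> [] \<longrightarrow> tall \<beta> (subtree s T) \<longrightarrow> tall (osuc \<beta>) (subtree s T))"
    using lusin_iter_iff_tall[OF T] by blast
  finally show ?thesis .
qed

lemma lusin_height_le:
  assumes "T \<in> Tr" "\<And>n. gap \<beta> (subtree [n] T)"
  shows "lusin_height T \<le> \<beta>"
  unfolding lusin_height_le_iff[OF assms(1)]
proof (intro allI impI)
  fix s assume "s \<noteq> []" "tall \<beta> (subtree s T)"
  then obtain n t where "subtree s T = subtree t (subtree [n] T)"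
    by (cases s) auto
  with assms(2)[of n] \<open>tall \<beta> (subtree s T)\<close> show "tall (osuc \<beta>) (subtree s T)"
    unfolding gap_def by (metis illD)
qed

lemma less_lusin_height:
  assumes "T \<in> Tr" "tall \<beta> (subtree [n] T)" "\<not> tall (osuc \<beta>) (subtree [n] T)"
  shows "\<beta> < lusin_height T"
  using lusin_height_le_iff[OF assms(1)] assms(2,3) by (metis list.distinct(1) not_le)


section \<open>Trees of prescribed rank\<close>

text \<open>The join of trees at a new root. An empty \<open>G n\<close> just means that the root
  has no child \<open>n\<close>.\<close>

definition graft :: "(nat \<Rightarrow> nat list set) \<Rightarrow> nat list set" where
  "graft G = insert [] {n # t | n t. t \<in> G n}"

lemma Nil_in_graft [simp]: "[] \<in> graft G"
  and Cons_in_graft [simp]: "n # t \<in> graft G \<longleftrightarrow> t \<in> G n"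
  by (auto simp: graft_def)

lemma subtree_graft [simp]: "subtree [n] (graft G) = G n"
  by (simp add: subtree_def)

lemma prefix_closed_graft: "(\<And>n. prefix_closed (G n)) \<Longrightarrow> prefix_closed (graft G)"
  unfolding prefix_closed_def graft_def by (force simp: append_eq_Cons_conv)

lemma tall_graft: "tall \<beta> (graft G) \<longleftrightarrow> (\<forall>\<gamma><\<beta>. \<exists>n. tall \<gamma> (G n))"
  by (subst tall.simps) simp

lemma tall_osuc_graft: "tall (osuc \<beta>) (graft G) \<longleftrightarrow> (\<exists>n. tall \<beta> (G n))"
  by (simp add: tall_osuc)

lemma ill_graft: "ill (G n) \<Longrightarrow> ill (graft G)"
  by (rule ill_parent[of _ n]) simp_all

text \<open>Joining trees that realise all ranks below \<open>\<gamma>\<close>, and none from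
  \<open>\<gamma>\<close> on, gives a root of rank exactly \<open>\<gamma>\<close>. Countability of
  \<open>{..<\<beta>}\<close> allows enumerating one such tree for each
  \<open>\<gamma> < \<beta>\<close>.\<close>

lemma cofinal_trees:
  "\<exists>F :: nat \<Rightarrow> nat list set. (\<forall>m. prefix_closed (F m) \<and> \<not> tall \<beta> (F m)) \<and>
     (\<forall>\<gamma><\<beta>. \<exists>m. tall \<gamma> (F m) \<and> \<not> tall (osuc \<gamma>) (F m))"
proof (induction \<beta> rule: less_induct)
  case (less \<beta>)
  show ?case
  proof (cases "\<beta> = 0")
    case True
    then show ?thesis by (intro exI[of _ "\<lambda>_. {}"]) simp
  next
    case False
    then have ne: "{..<\<beta>} \<noteq> {}" by (auto simp: cord_pos_iff[symmetric])
    have "\<exists>F. prefix_closed F \<and> tall \<gamma> F \<and> \<not> tall (osuc \<gamma>) F" if \<gamma>: "\<gamma> < \<beta>" for \<gamma>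
    proof -
      obtain G :: "nat \<Rightarrow> nat list set" where "\<And>m. prefix_closed (G m) \<and> \<not> tall \<gamma> (G m)"
        "\<forall>\<delta><\<gamma>. \<exists>m. tall \<delta> (G m) \<and> \<not> tall (osuc \<delta>) (G m)"
        using less.IH[OF \<gamma>] by metis
      then show ?thesis
        by (intro exI[of _ "graft G"]) (auto simp: tall_graft tall_osuc_graft intro: prefix_closed_graft)
    qed
    then obtain F where
      F: "\<And>\<gamma>. \<gamma> < \<beta> \<Longrightarrow> prefix_closed (F \<gamma>) \<and> tall \<gamma> (F \<gamma>) \<and> \<not> tall (osuc \<gamma>) (F \<gamma>)"
      by metis
    let ?e = "from_nat_into {..<\<beta>}"
    have e: "?e m < \<beta>" for m using from_nat_into[OF ne] by auto
    have "\<not> tall \<beta> (F (?e m))" for m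
      using F[OF e[of m]] e[of m] tall_antimono by (metis osuc_le_iff)
    moreover have "\<exists>m. ?e m = \<gamma>" if "\<gamma> < \<beta>" for \<gamma>
      using from_nat_into_surj[OF countable_lessThan_cord] that by blast
    ultimately show ?thesis
      using F e by (intro exI[of _ "\<lambda>m. F (?e m)"]) metis
  qed
qed


section \<open>Staggered products\<close>

definition slot :: "nat \<Rightarrow> nat \<Rightarrow> nat" where
  "slot i c = (if i < length (list_decode c) then list_decode c ! i else 0)"

text \<open>A node of \<open>stagger 0 G\<close> runs through all trees \<open>G i\<close> in parallel, the walk through \<open>G i\<close>
  starting only at level \<open>i\<close>; a natural number encodes one step in each of the trees already
  entered. In \<open>stagger j G\<close> the first \<open>j\<close> levels are over; the truncated \<open>i - j\<close> is the
  number of levels before \<open>G i\<close> is entered.\<close>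

definition stagger :: "nat \<Rightarrow> (nat \<Rightarrow> nat list set) \<Rightarrow> nat list set" where
  "stagger j G = {u. \<forall>i. map (slot i) (drop (i - j) u) \<in> G i}"

definition advance :: "nat \<Rightarrow> nat \<Rightarrow> (nat \<Rightarrow> nat list set) \<Rightarrow> nat \<Rightarrow> nat list set" where
  "advance j c G i = (if i \<le> j then subtree [slot i c] (G i) else G i)"

text \<open>This is the reason for staggering: at level \<open>j\<close> only finitely many factors
  move, and finitely many simultaneous steps fit into one natural number.\<close>

lemma slot_surj: "\<exists>c. \<forall>i\<le>j. slot i c = f i"
  by (intro exI[of _ "list_encode (map f [0..<Suc j])"]) (auto simp: slot_def nth_append simp del: upt_Suc)

text \<open>Entered factors have delay 0 and read \<open>c\<close>; for the others
  \<open>drop\<close> discards \<open>c\<close> and the delay shrinks by one. Subtrees are thus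
  staggered products again, so the inductions below keep \<open>j\<close> and \<open>G\<close>
  arbitrary.\<close>

lemma subtree_stagger: "subtree [c] (stagger j G) = stagger (Suc j) (advance j c G)"
proof -
  have "map (slot i) (drop (i - j) (c # u)) \<in> G i \<longleftrightarrow>
      map (slot i) (drop (i - Suc j) u) \<in> advance j c G i" for i u
    by (cases "i \<le> j") (auto simp: advance_def subtree_def drop_Cons' Suc_diff_Suc)
  then show ?thesis by (simp add: stagger_def subtree_def)
qed

lemma Nil_in_stagger: "[] \<in> stagger j G \<longleftrightarrow> (\<forall>i. [] \<in> G i)"
  by (simp add: stagger_def)

lemma prefix_closed_stagger:
  "(\<And>i. prefix_closed (G i)) \<Longrightarrow> prefix_closed (stagger j G)"
  unfolding prefix_closed_def stagger_def by simp blast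

section \<open>Ranks in staggered products\<close>

lemma tall_stagger:
  "tall \<beta> (stagger j G) \<Longrightarrow> i \<le> j \<Longrightarrow> tall \<beta> (G i)"
proof (induction \<beta> arbitrary: j G rule: less_induct)
  case (less \<beta>)
  have "[] \<in> G i" using tall_root[OF less.prems(1)] by (simp add: Nil_in_stagger)
  moreover have "\<exists>n. tall \<gamma> (subtree [n] (G i))" if \<gamma>: "\<gamma> < \<beta>" for \<gamma>
  proof -
    obtain c where "tall \<gamma> (stagger (Suc j) (advance j c G))"
      using less.prems(1) \<gamma> by (subst (asm) tall.simps) (auto simp: subtree_stagger)
    then have "tall \<gamma> (advance j c G i)" using less.IH[OF \<gamma>] less.prems(2) by simp
    then show ?thesis using less.prems(2) by (auto simp: advance_def)
  qed
  ultimately show ?case by (subst tall.simps) blast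
qed

text \<open>Each level before \<open>G i\<close> is entered costs one unit of rank; afterwards a
  walk in the product projects to a walk in \<open>G i\<close>.\<close>

lemma tall_stagger_delayed:
  "tall ((osuc ^^ (i - j)) \<beta>) (stagger j G) \<Longrightarrow> tall \<beta> (G i)"
proof (induction "i - j" arbitrary: j G)
  case 0
  then show ?case using tall_stagger[of \<beta> j G i] by simp
next
  case (Suc d)
  then have d: "i - j = Suc (i - Suc j)" "d = i - Suc j" by auto
  obtain c where "tall ((osuc ^^ (i - Suc j)) \<beta>) (stagger (Suc j) (advance j c G))"
    using Suc.prems unfolding d(1) by (auto simp: tall_osuc subtree_stagger)
  then have "tall \<beta> (advance j c G i)" using Suc.hyps(1)[OF d(2)] by blast
  moreover have "\<not> i \<le> j" using d(1) by linarith
  ultimately show ?case by (simp add: advance_def)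
qed

text \<open>One label \<open>c\<close> can follow an ill-founded child in every entered factor while
  the others wait, so all factors remain ill-founded and the induction on \<open>\<beta>\<close>
  continues.\<close>

lemma ill_stagger:
  assumes "\<And>i. ill (G i)" shows "ill (stagger j G)"
proof -
  have "tall \<beta> (stagger j G)" if "\<forall>i. ill (G i)" for \<beta>
    using that
  proof (induction \<beta> arbitrary: j G rule: less_induct)
    case (less \<beta>)
    have "\<forall>i. \<exists>n. ill (subtree [n] (G i))" using less.prems ill_child by blast
    then obtain f where f: "\<And>i. ill (subtree [f i] (G i))" by metis
    obtain c where "\<forall>i\<le>j. slot i c = f i" using slot_surj by blast
    then have "\<forall>i. ill (advance j c G i)" using f less.prems by (simp add: advance_def)
    then have "tall \<gamma> (subtree [c] (stagger j G))" if "\<gamma> < \<beta>" for \<gamma>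
      using less.IH[OF that] by (simp add: subtree_stagger)
    moreover have "[] \<in> stagger j G"
      using less.prems by (auto simp: Nil_in_stagger intro: tall_root[OF illD])
    ultimately show ?case by (subst tall.simps) blast
  qed
  with assms show ?thesis by (simp add: ill_def)
qed

text \<open>The bound \<open>\<beta>\<close> absorbs every finite delay: rank \<open>\<beta>\<close>
  of the product forces rank \<open>\<delta> i\<close> in each factor, hence ill-foundedness of all
  factors and of the product.\<close>

lemma gap_stagger:
  assumes gap: "\<And>i. gap (\<delta> i) (G i)" and \<delta>: "\<And>i n. (osuc ^^ n) (\<delta> i) \<le> \<beta>"
  shows "gap \<beta> (stagger j G)"
proof -
  have "tall \<beta> (subtree s (stagger j G)) \<longrightarrow> ill (subtree s (stagger j G))"
    if "\<forall>i. gap (\<delta> i) (G i)" for s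
    using that
  proof (induction s arbitrary: j G)
    case Nil
    show ?case
    proof
      assume t: "tall \<beta> (subtree [] (stagger j G))"
      have "tall (\<delta> i) (G i)" for i
        by (rule tall_stagger_delayed[of i j]) (use t tall_antimono \<delta> in auto)
      then show "ill (subtree [] (stagger j G))"
        using Nil gapD by (auto intro!: ill_stagger)
    qed
  next
    case (Cons c s)
    have "\<forall>i. gap (\<delta> i) (advance j c G i)"
      using Cons.prems by (simp add: advance_def gap_subtree)
    then have "tall \<beta> (subtree s (stagger (Suc j) (advance j c G))) \<longrightarrow>
        ill (subtree s (stagger (Suc j) (advance j c G)))"
      by (rule Cons.IH)
    then show ?case by (simp add: subtree_stagger[symmetric])
  qed
  with gap show ?thesis by (simp add: gap_def)
qed


section \<open>Continuous families of trees\<close>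

definition tree_family :: "'a topology \<Rightarrow> ('a \<Rightarrow> nat list set) \<Rightarrow> bool" where
  "tree_family X h \<longleftrightarrow> (\<forall>x. prefix_closed (h x)) \<and>
     (\<forall>s. openin X {x \<in> topspace X. s \<in> h x} \<and> closedin X {x \<in> topspace X. s \<in> h x})"

text \<open>The form delivered by staggered products: outside \<open>P\<close> the tree only fails
  to have rank \<open>\<beta>\<close>, whereas \<open>sharply_codes\<close> prescribes the rank
  exactly.\<close>

definition codes :: "'a topology \<Rightarrow> cord \<Rightarrow> 'a set \<Rightarrow> ('a \<Rightarrow> nat list set) \<Rightarrow> bool" where
  "codes X \<beta> P h \<longleftrightarrow> tree_family X h \<and>
     (\<forall>x\<in>topspace X. gap \<beta> (h x) \<and> (ill (h x) \<longleftrightarrow> x \<in> P))"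

definition sharply_codes :: "'a topology \<Rightarrow> cord \<Rightarrow> 'a set \<Rightarrow> ('a \<Rightarrow> nat list set) \<Rightarrow> bool" where
  "sharply_codes X \<beta> B g \<longleftrightarrow> tree_family X g \<and>
     (\<forall>x\<in>topspace X. if x \<in> B then ill (g x) \<and> gap \<beta> (g x)
       else tall \<beta> (g x) \<and> \<not> tall (osuc \<beta>) (g x))"

section \<open>Continuity of the tree constructions\<close>

lemma tree_family_const: "prefix_closed T \<Longrightarrow> tree_family X (\<lambda>_. T)"
proof -
  have "{x \<in> topspace X. s \<in> T} = (if s \<in> T then topspace X else {})" for s by simp
  then show "prefix_closed T \<Longrightarrow> tree_family X (\<lambda>_. T)" by (simp add: tree_family_def)
qed

lemma tree_family_graft:
  assumes "\<And>n. tree_family X (\<lambda>x. G n x)"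
  shows "tree_family X (\<lambda>x. graft (\<lambda>n. G n x))"
proof -
  have "openin X {x \<in> topspace X. s \<in> graft (\<lambda>n. G n x)} \<and>
      closedin X {x \<in> topspace X. s \<in> graft (\<lambda>n. G n x)}" for s
    using assms by (cases s) (simp_all add: tree_family_def)
  then show ?thesis
    using assms by (auto simp: tree_family_def intro: prefix_closed_graft)
qed

text \<open>For a node \<open>u\<close>, the factors beyond \<open>length u\<close> only require
  their roots, which are present. Membership of \<open>u\<close> is thus a finite intersection of
  clopen conditions.\<close>

lemma tree_family_stagger:
  assumes g: "\<And>i. tree_family X (g i)" and root: "\<And>i x. x \<in> topspace X \<Longrightarrow> [] \<in> g i x"
  shows "tree_family X (\<lambda>x. stagger 0 (\<lambda>i. g i x))"
proof -
  let ?S = "\<lambda>u i. {x \<in> topspace X. map (slot i) (drop i u) \<in> g i x}"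
  have eq: "{x \<in> topspace X. u \<in> stagger 0 (\<lambda>i. g i x)} = (\<Inter>i\<in>{..length u}. ?S u i)" for u
  proof (intro subset_antisym subsetI)
    fix x assume x: "x \<in> (\<Inter>i\<in>{..length u}. ?S u i)"
    have "map (slot i) (drop i u) \<in> g i x" for i
      using x root[of x i] by (cases "i \<le> length u") auto
    with x show "x \<in> {x \<in> topspace X. u \<in> stagger 0 (\<lambda>i. g i x)}"
      by (auto simp: stagger_def)
  qed (auto simp: stagger_def)
  have "openin X (\<Inter>i\<in>{..length u}. ?S u i) \<and> closedin X (\<Inter>i\<in>{..length u}. ?S u i)" for u
    using g unfolding tree_family_def by (intro conjI openin_INT2 closedin_Inter) auto
  then show ?thesis
    using g unfolding tree_family_def eq by (simp add: prefix_closed_stagger)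
qed

lemma tree_family_continuous:
  assumes "tree_family X f" "\<And>x. [] \<in> f x"
  shows "continuous_map X Tr_space f"
proof -
  have "continuous_map X (discrete_topology UNIV) (\<lambda>x. s \<in> f x)" for s
  proof -
    let ?S = "{x \<in> topspace X. s \<in> f x}"
    have "openin X ?S" "openin X (topspace X - ?S)"
      using assms(1) by (auto simp: tree_family_def closedin_def)
    moreover have "{x \<in> topspace X. (s \<in> f x) \<in> U} =
      (if True \<in> U then ?S else {}) \<union> (if False \<in> U then topspace X - ?S else {})" for U
      by (cases "True \<in> U"; cases "False \<in> U") (auto intro: ccontr, (metis (full_types))+)
    ultimately show ?thesis by (simp add: continuous_map_def openin_Un)
  qed
  then have "continuous_map X (product_topology (\<lambda>_. discrete_topology (UNIV :: bool set)) UNIV)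
      ((\<lambda>T s. s \<in> T) \<circ> f)"
    by (simp add: continuous_map_componentwise_UNIV)
  moreover have "f \<in> topspace X \<rightarrow> Tr"
    using assms by (auto simp: Tr_iff tree_family_def)
  ultimately show ?thesis
    unfolding Tr_space_def by (intro continuous_map_pullback') auto
qed

section \<open>Set operations on codings\<close>

lemma sharply_codes_gap:
  assumes "sharply_codes X \<beta> B g" "x \<in> topspace X"
  shows "gap (osuc \<beta>) (g x)"
proof (cases "x \<in> B")
  case True
  with assms have "gap \<beta> (g x)" by (auto simp: sharply_codes_def)
  then show ?thesis by (rule gap_mono) (simp add: less_imp_le)
next
  case False
  with assms show ?thesis
    by (auto simp: sharply_codes_def tree_family_def intro: gap_not_tall)
qed

lemma sharply_codes_ill:
  assumes "sharply_codes X \<beta> B g" "x \<in> topspace X"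
  shows "ill (g x) \<longleftrightarrow> x \<in> B"
  using assms illD by (auto simp: sharply_codes_def split: if_splits)

text \<open>All nodes of \<open>UNIV\<close> are ill-founded and the empty tree fails even
  \<open>tall 0\<close>, so this works for every \<open>\<beta>\<close>, including 0.\<close>

lemma codes_clopen:
  assumes "openin X P" "closedin X P"
  shows "codes X \<beta> P (\<lambda>x. if x \<in> P then UNIV else {})"
proof -
  have "{x \<in> topspace X. s \<in> (if x \<in> P then UNIV else {})} = P" for s :: "nat list"
    using openin_subset[OF assms(1)] by auto
  with assms show ?thesis by (auto simp: codes_def tree_family_def)
qed

lemma codes_INT:
  assumes g: "\<And>i. sharply_codes X (\<delta> i) (Q i) (g i)"
    and \<delta>: "\<And>i n. (osuc ^^ n) (\<delta> i) \<le> \<beta>"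
  shows "codes X \<beta> (\<Inter>i. Q i) (\<lambda>x. stagger 0 (\<lambda>i. g i x))"
proof -
  have fam: "tree_family X (g i)" for i
    using g by (simp add: sharply_codes_def)
  have root: "[] \<in> g i x" if "x \<in> topspace X" for i x
    using g[of i] that unfolding sharply_codes_def by (meson illD tall_root)
  have "gap \<beta> (stagger 0 (\<lambda>i. g i x)) \<and> (ill (stagger 0 (\<lambda>i. g i x)) \<longleftrightarrow> x \<in> (\<Inter>i. Q i))"
    if x: "x \<in> topspace X" for x
  proof
    \<comment> \<open>Outside \<open>Q i\<close> the factor has rank exactly
      \<open>\<delta> i\<close>, so its gap starts one later; that extra successor is absorbed as
      well.\<close>
    have "(osuc ^^ n) (osuc (\<delta> i)) \<le> \<beta>" for i n
      using \<delta>[of "Suc n" i] by (simp add: funpow_swap1)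
    then show "gap \<beta> (stagger 0 (\<lambda>i. g i x))"
      using sharply_codes_gap[OF g x] by (intro gap_stagger) auto
    have "ill (g i x)" if "ill (stagger 0 (\<lambda>i. g i x))" for i
    proof (rule gapD[OF sharply_codes_gap[OF g x]])
      show "tall (osuc (\<delta> i)) (g i x)"
        by (rule tall_stagger_delayed[of i 0 _ "\<lambda>i. g i x"]) (use that illD in blast)
    qed
    moreover have "ill (stagger 0 (\<lambda>i. g i x))" if "\<And>i. ill (g i x)"
      using that by (rule ill_stagger)
    ultimately show "ill (stagger 0 (\<lambda>i. g i x)) \<longleftrightarrow> x \<in> (\<Inter>i. Q i)"
      using sharply_codes_ill[OF g x] by auto
  qed
  then show ?thesis
    using tree_family_stagger[OF fam root] by (simp add: codes_def)
qed

text \<open>The join is ill-founded iff some \<open>h m x\<close> is. Otherwise all children have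
  rank below \<open>\<beta>\<close>, and the fixed trees \<open>F\<close> push the root up to
  exactly \<open>\<beta>\<close>.\<close>

lemma sharply_codes_UN:
  fixes P :: "nat \<Rightarrow> 'a set"
  assumes h: "\<And>m. codes X \<beta> (P m) (h m)"
  shows "\<exists>g. sharply_codes X \<beta> (\<Union>m. P m) g"
proof -
  obtain F :: "nat \<Rightarrow> nat list set" where F: "\<And>m. prefix_closed (F m)" "\<And>m. \<not> tall \<beta> (F m)"
    "\<And>\<gamma>. \<gamma> < \<beta> \<Longrightarrow> \<exists>m. tall \<gamma> (F m)"
    using cofinal_trees[of \<beta>] by metis
  \<comment> \<open>Even children carry the given codings, odd ones the fixed trees.\<close>
  define G where "G n x = (if even n then h (n div 2) x else F (n div 2))" for n x
  have G: "G (2 * m) x = h m x" "G (Suc (2 * m)) x = F m" for m x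
    by (simp_all add: G_def)
  have fam: "tree_family X (\<lambda>x. G n x)" for n
    using h F(1) by (cases "even n") (auto simp: G_def codes_def intro: tree_family_const)
  have gapG: "gap \<beta> (G n x)" if "x \<in> topspace X" for n x
    using h F that by (auto simp: G_def codes_def intro: gap_not_tall)
  have "if x \<in> (\<Union>m. P m) then ill (graft (\<lambda>n. G n x)) \<and> gap \<beta> (graft (\<lambda>n. G n x))
      else tall \<beta> (graft (\<lambda>n. G n x)) \<and> \<not> tall (osuc \<beta>) (graft (\<lambda>n. G n x))"
    if x: "x \<in> topspace X" for x
  proof (cases "x \<in> (\<Union>m. P m)")
    case True
    then obtain m where "x \<in> P m" by blast
    then have "ill (G (2 * m) x)" using h[of m] x by (simp add: codes_def G)
    then have "ill (graft (\<lambda>n. G n x))" by (rule ill_graft)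
    with True gapG[OF x] show ?thesis by (simp add: gap_iff[of \<beta> "graft _"])
  next
    case False
    have "\<not> tall \<beta> (G n x)" for n
    proof
      assume t: "tall \<beta> (G n x)"
      then have "even n" using F(2)[of "n div 2"] by (cases "even n") (simp_all add: G_def)
      with gapD[OF gapG[OF x] t] have "ill (h (n div 2) x)" by (simp add: G_def)
      with h[of "n div 2"] x False show False by (auto simp: codes_def)
    qed
    moreover have "\<exists>n. tall \<gamma> (G n x)" if "\<gamma> < \<beta>" for \<gamma>
      using F(3)[OF that] G(2) by metis
    ultimately show ?thesis using False by (simp add: tall_graft[of \<beta>] tall_osuc_graft)
  qed
  with tree_family_graft[of X G, OF fam] show ?thesis
    unfolding sharply_codes_def by (intro exI[of _ "\<lambda>x. graft (\<lambda>n. G n x)"] conjI ballI)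
qed

text \<open>A new root with a single child raises an ordinal rank by one and preserves
  ill-foundedness.\<close>

lemma sharply_codes_osuc:
  assumes g: "sharply_codes X \<beta> B g"
  shows "sharply_codes X (osuc \<beta>) B (\<lambda>x. graft (\<lambda>n. if n = 0 then g x else {}))"
proof -
  have "tree_family X (\<lambda>x. if n = 0 then g x else {})" for n :: nat
    using g by (cases "n = 0") (auto simp: sharply_codes_def intro: tree_family_const)
  then have "tree_family X (\<lambda>x. graft (\<lambda>n. if n = 0 then g x else {}))"
    by (rule tree_family_graft)
  moreover have "ill (graft (\<lambda>n. if n = 0 then T else {})) \<and>
      gap (osuc \<beta>) (graft (\<lambda>n. if n = 0 then T else {}))" if "ill T" "gap \<beta> T" for T
  proof -
    have "ill (graft (\<lambda>n. if n = 0 then T else {}))"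
      using that(1) by (intro ill_graft[of _ 0]) simp
    moreover have "gap (osuc \<beta>) T"
      using that(2) by (rule gap_mono) (simp add: less_imp_le)
    ultimately show ?thesis by (subst gap_iff) simp
  qed
  moreover have "tall (osuc \<gamma>) (graft (\<lambda>n. if n = 0 then T else {})) \<longleftrightarrow> tall \<gamma> T" for \<gamma> T
    by (auto simp: tall_osuc_graft split: if_splits)
  ultimately show ?thesis
    using g by (simp add: sharply_codes_def)
qed

lemma Sigma0_sharply_coded:
  assumes base: "has_clopen_base X" and "Sigma0 X (osuc (2 * \<alpha>)) B"
  shows "\<exists>g. sharply_codes X (\<omega> * \<alpha>) B g"
  using assms(2)
proof (induction \<alpha> arbitrary: B rule: less_induct)
  case (less \<alpha>)
  have "\<exists>P. B = (\<Union>m :: nat. P m) \<and> (\<forall>m. \<exists>h. codes X (\<omega> * \<alpha>) (P m) h)"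
  proof (cases "\<alpha> = 0")
    case True
    then have "openin X B" using less.prems by (simp add: Sigma0_1_iff one_cord_def[symmetric])
    then obtain C :: "nat \<Rightarrow> 'a set" where "\<And>n. openin X (C n) \<and> closedin X (C n)" "B = (\<Union>n. C n)"
      using open_eq_Union_clopen[OF base] by metis
    then show ?thesis using codes_clopen by blast
  next
    case False
    have pos: "1 < 2 * \<alpha>"
      using two_mult_less[of 0 \<alpha>] False by (simp add: cord_pos_iff one_cord_def)
    then have "1 < osuc (2 * \<alpha>)" by (simp add: less_imp_le)
    then obtain P :: "nat \<Rightarrow> 'a set"
      where P: "B = (\<Union>m. P m)" "\<And>m. \<exists>\<eta><osuc (2 * \<alpha>). Pi0 X \<eta> (P m)"
      using Sigma0_higherE[OF less.prems] by metis
    have "\<exists>h. codes X (\<omega> * \<alpha>) (P m) h" for m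
    proof -
      \<comment> \<open>All members of the union are brought to the common even index, so that one
        countable intersection can be unfolded next.\<close>
      have "Pi0 X (2 * \<alpha>) (P m)"
        using P(2)[of m] Pi0_mono[OF base] by auto
      then obtain Q :: "nat \<Rightarrow> 'a set"
        where Q: "P m = (\<Inter>i. Q i)" "\<And>i. \<exists>\<eta><2 * \<alpha>. Sigma0 X \<eta> (Q i)"
        using Pi0_higherE[OF _ pos] by metis
      have "\<exists>\<gamma><\<alpha>. \<exists>g. sharply_codes X (\<omega> * \<gamma>) (Q i) g" for i
      proof -
        obtain \<eta> where \<eta>: "\<eta> < 2 * \<alpha>" "Sigma0 X \<eta> (Q i)" using Q(2) by blast
        then obtain \<gamma> where \<gamma>: "\<gamma> < \<alpha>" "\<eta> \<le> osuc (2 * \<gamma>)" using less_two_multD by blast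
        with \<eta>(2) have "Sigma0 X (osuc (2 * \<gamma>)) (Q i)" by (metis Sigma0_mono[OF base])
        with less.IH \<gamma>(1) show ?thesis by blast
      qed
      then obtain \<gamma> g where g: "\<And>i. \<gamma> i < \<alpha>" "\<And>i. sharply_codes X (\<omega> * \<gamma> i) (Q i) (g i)"
        by metis
      \<comment> \<open>No uniform bound on \<open>\<gamma> i\<close> is needed: each delay is
        finite, and \<open>\<gamma> i < \<alpha>\<close> leaves room for it.\<close>
      have "(osuc ^^ n) (\<omega> * \<gamma> i) \<le> \<omega> * \<alpha>" for i n
        using omega_mult_less[OF g(1)[of i], of n] by (simp add: cord_add_ord_of_nat)
      then have "codes X (\<omega> * \<alpha>) (\<Inter>i. Q i) (\<lambda>x. stagger 0 (\<lambda>i. g i x))"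
        by (intro codes_INT[of X "\<lambda>i. \<omega> * \<gamma> i"] g(2))
      then show ?thesis unfolding Q(1) by blast
    qed
    with P(1) show ?thesis by blast
  qed
  then obtain P h where "B = (\<Union>m :: nat. P m)" "\<And>m. codes X (\<omega> * \<alpha>) (P m) (h m)" by metis
  then show ?case using sharply_codes_UN[of X _ P h] by simp
qed

lemma Sigma0_sharply_coded_add:
  assumes "has_clopen_base X" "Sigma0 X (osuc (2 * \<alpha>)) B"
  shows "\<exists>g. sharply_codes X (\<omega> * \<alpha> + ord_of_nat k) B g"
proof (induction k)
  case 0
  show ?case using Sigma0_sharply_coded[OF assms] by (simp add: ord_of_nat_def)
next
  case (Suc k)
  then obtain g where "sharply_codes X (\<omega> * \<alpha> + ord_of_nat k) B g" by blast
  from sharply_codes_osuc[OF this] show ?case by (auto simp: cord_add_ord_of_nat)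
qed

text \<open>The children of the root decide the height: for \<open>x\<close> in \<open>A\<close>
  none contains a node of ordinal rank \<open>\<beta>\<close> or more, while for \<open>x\<close>
  outside some \<open>B n\<close> one child has rank exactly \<open>\<beta>\<close>.\<close>

lemma Pi0_height_reduction:
  assumes base: "has_clopen_base X" and A: "Pi0 X (2 * \<alpha> + 2) A"
  shows "\<exists>f. continuous_map X Tr_space f \<and>
    (\<forall>x\<in>topspace X. lusin_height (f x) =
      (if x \<in> A then \<omega> * \<alpha> + ord_of_nat k else osuc (\<omega> * \<alpha> + ord_of_nat k)))"
proof -
  define \<beta> where "\<beta> = \<omega> * \<alpha> + ord_of_nat k"
  have "1 < 2 * \<alpha> + 2" by (simp add: cord_add_2 one_cord_def)
  then obtain B :: "nat \<Rightarrow> 'a set"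
    where B: "A = (\<Inter>n. B n)" "\<And>n. \<exists>\<eta><2 * \<alpha> + 2. Sigma0 X \<eta> (B n)"
    using Pi0_higherE[OF A] by metis
  have "\<exists>g. sharply_codes X \<beta> (B n) g" for n
  proof -
    have "Sigma0 X (osuc (2 * \<alpha>)) (B n)"
      using B(2)[of n] Sigma0_mono[OF base] by (auto simp: cord_add_2)
    then show ?thesis unfolding \<beta>_def by (rule Sigma0_sharply_coded_add[OF base])
  qed
  then obtain g where g: "\<And>n. sharply_codes X \<beta> (B n) (g n)" by metis
  obtain F :: "nat \<Rightarrow> nat list set" where F: "\<And>m. prefix_closed (F m)" "\<And>m. \<not> tall \<beta> (F m)"
    "\<And>\<gamma>. \<gamma> < \<beta> \<Longrightarrow> \<exists>m. tall \<gamma> (F m) \<and> \<not> tall (osuc \<gamma>) (F m)"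
    using cofinal_trees[of \<beta>] by metis
  define G where "G n x = (if even n then g (n div 2) x else F (n div 2))" for n x
  have G: "G (2 * m) x = g m x" "G (Suc (2 * m)) x = F m" for m x
    by (simp_all add: G_def)
  have fam: "tree_family X (\<lambda>x. G n x)" for n
    using g F(1) by (cases "even n") (auto simp: G_def sharply_codes_def intro: tree_family_const)
  define f where "f x = graft (\<lambda>n. G n x)" for x
  have famf: "tree_family X f"
    unfolding f_def[abs_def] using fam by (rule tree_family_graft)
  have sub: "subtree [n] (f x) = G n x" for n x by (simp add: f_def)
  have Tr: "f x \<in> Tr" for x
    using famf by (simp add: Tr_iff tree_family_def) (simp add: f_def)
  \<comment> \<open>If the height were below \<open>\<beta>\<close>, some \<open>F m\<close> would
    have exactly that rank, making the height exceed itself.\<close>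
  have ge: "\<beta> \<le> lusin_height (f x)" for x
  proof (rule ccontr)
    assume "\<not> ?thesis"
    then obtain m where "tall (lusin_height (f x)) (F m)" "\<not> tall (osuc (lusin_height (f x))) (F m)"
      using F(3) by (metis not_le)
    then have "lusin_height (f x) < lusin_height (f x)"
      using less_lusin_height[OF Tr, of "lusin_height (f x)" "Suc (2 * m)" x] by (simp add: sub G)
    then show False by simp
  qed
  have gapF: "gap \<beta> (F m)" for m using F by (intro gap_not_tall)
  have "lusin_height (f x) = (if x \<in> A then \<beta> else osuc \<beta>)" if x: "x \<in> topspace X" for x
  proof (cases "x \<in> A")
    case True
    then have "gap \<beta> (g n x)" for n
      using g[of n] x B(1) by (auto simp: sharply_codes_def)
    then have "lusin_height (f x) \<le> \<beta>"
      using gapF by (intro lusin_height_le[OF Tr]) (simp add: sub G_def)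
    with ge[of x] True show ?thesis by simp
  next
    case False
    then obtain n where "x \<notin> B n" using B(1) by blast
    then have "tall \<beta> (g n x)" "\<not> tall (osuc \<beta>) (g n x)"
      using g[of n] x by (auto simp: sharply_codes_def)
    then have "\<beta> < lusin_height (f x)"
      using less_lusin_height[OF Tr, of \<beta> "2 * n" x] by (simp add: sub G)
    moreover have "gap (osuc \<beta>) (F m)" for m
      using gapF by (rule gap_mono) (simp add: less_imp_le)
    then have "lusin_height (f x) \<le> osuc \<beta>"
      using sharply_codes_gap[OF g x] by (intro lusin_height_le[OF Tr]) (simp add: sub G_def)
    ultimately show ?thesis using False by (simp add: order_antisym)
  qed
  moreover have "continuous_map X Tr_space f"
    using famf by (rule tree_family_continuous) (simp add: f_def)
  ultimately show ?thesis unfolding \<beta>_def by blast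
qed


section \<open>Complexity of the height\<close>

text \<open>One more unit of rank asks for a suitable child, a countable union; finite increments
  therefore stay in the same class.\<close>

lemma Sigma0_subtree_tall_add:
  assumes s: "s \<noteq> []" and "\<And>s. s \<noteq> [] \<Longrightarrow> Sigma0 Tr_space \<xi> {T \<in> Tr. tall \<beta> (subtree s T)}"
  shows "Sigma0 Tr_space \<xi> {T \<in> Tr. tall ((osuc ^^ n) \<beta>) (subtree s T)}"
  using s
proof (induction n arbitrary: s)
  case 0
  then show ?case using assms(2) by simp
next
  case (Suc n)
  have "[] \<in> subtree s T" if "T \<in> Tr" "tall \<gamma> (subtree (s @ [i]) T)" for T \<gamma> i
    using tall_root[OF that(2)] that(1) by (auto simp: Tr_iff prefix_closed_def subtree_def)
  then have "{T \<in> Tr. tall ((osuc ^^ Suc n) \<beta>) (subtree s T)} =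
      (\<Union>i. {T \<in> Tr. tall ((osuc ^^ n) \<beta>) (subtree (s @ [i]) T)})"
    by (auto simp: tall_osuc)
  moreover have "Sigma0 Tr_space \<xi> (\<Union>i. {T \<in> Tr. tall ((osuc ^^ n) \<beta>) (subtree (s @ [i]) T)})"
    by (intro Sigma0_UN_nat[OF has_clopen_base_Tr_space] Suc.IH) simp
  ultimately show ?case by simp
qed

lemma clopen_mem_Tr_space:
  "openin Tr_space {T \<in> Tr. s \<in> T} \<and> closedin Tr_space {T \<in> Tr. s \<in> T}"
proof -
  have "continuous_map Tr_space (discrete_topology UNIV) ((\<lambda>f. f s) \<circ> (\<lambda>T s. s \<in> T))"
    unfolding Tr_space_def
    by (intro continuous_map_pullback continuous_map_product_projection) simp
  then show ?thesis
    using openin_continuous_map_preimage[of Tr_space "discrete_topology UNIV" _ "{True}"]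
      closedin_continuous_map_preimage[of Tr_space "discrete_topology UNIV" _ "{True}"]
    by fastforce
qed

text \<open>For nonzero \<open>\<alpha>\<close>, rank at least \<open>\<omega> * \<alpha>\<close>
  means rank at least \<open>\<omega> * \<gamma> + n\<close> for all
  \<open>\<gamma> < \<alpha>\<close> and all \<open>n\<close>. Each condition has class
  \<open>Sigma0\<close> at \<open>osuc (2 * \<gamma>)\<close>, so the intersection is even
  \<open>Pi0\<close> at \<open>2 * \<alpha>\<close>.\<close>

lemma Delta0_subtree_tall:
  assumes "s \<noteq> []"
  shows "Delta0 Tr_space (osuc (2 * \<alpha>)) {T \<in> Tr. tall (\<omega> * \<alpha>) (subtree s T)}"
  using assms
proof (induction \<alpha> arbitrary: s rule: less_induct)
  case (less \<alpha>)
  show ?case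
  proof (cases "\<alpha> = 0")
    case True
    have "{T \<in> Tr. tall 0 (subtree s T)} = {T \<in> Tr. s \<in> T}"
      by (subst tall.simps) (simp add: subtree_def)
    then show ?thesis
      using True clopen_mem_Tr_space[of s]
      by (auto simp: Delta0_def Pi0_def Sigma0_1_iff closedin_def one_cord_def[symmetric])
  next
    case False
    let ?S = "\<lambda>\<gamma> n. {T \<in> Tr. tall (\<omega> * \<gamma> + ord_of_nat n) (subtree s T)}"
    have eq: "tall (\<omega> * \<alpha>) T \<longleftrightarrow> (\<forall>\<gamma><\<alpha>. \<forall>n. tall (\<omega> * \<gamma> + ord_of_nat n) T)" for T
      unfolding tall_olimit[OF olimit_omega_mult[OF False]]
      using less_omega_multD[of _ \<alpha>] omega_mult_less[of _ \<alpha>] tall_antimono less_imp_le by metis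
    have "{T \<in> Tr. tall (\<omega> * \<alpha>) (subtree s T)} = (\<Inter>\<gamma>\<in>{..<\<alpha>}. \<Inter>n. ?S \<gamma> n)"
    proof (intro subset_antisym subsetI)
      fix T assume T: "T \<in> (\<Inter>\<gamma>\<in>{..<\<alpha>}. \<Inter>n. ?S \<gamma> n)"
      moreover have "0 \<in> {..<\<alpha>}" using False by (simp add: cord_pos_iff)
      ultimately have "T \<in> ?S 0 0" by (meson INT_D UNIV_I)
      with T show "T \<in> {T \<in> Tr. tall (\<omega> * \<alpha>) (subtree s T)}" by (auto simp: eq)
    qed (auto simp: eq)
    moreover have "Pi0 Tr_space (2 * \<alpha>) (?S \<gamma> n)" if "\<gamma> < \<alpha>" for \<gamma> n
    proof (rule Sigma0_imp_Pi0[OF _ two_mult_less[OF that]])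
      show "Sigma0 Tr_space (osuc (2 * \<gamma>)) (?S \<gamma> n)"
        unfolding cord_add_ord_of_nat using less.IH[OF that]
        by (intro Sigma0_subtree_tall_add less.prems) (simp add: Delta0_def)
    qed
    then have "Pi0 Tr_space (2 * \<alpha>) (\<Inter>\<gamma>\<in>{..<\<alpha>}. \<Inter>n. ?S \<gamma> n)"
      using False by (intro Pi0_INT[OF has_clopen_base_Tr_space])
        (auto simp: countable_lessThan_cord cord_pos_iff[symmetric])
    ultimately show ?thesis using Delta0_osuc[OF has_clopen_base_Tr_space] by simp
  qed
qed

text \<open>That no nonempty \<open>s\<close> has rank exactly
  \<open>\<omega> * \<alpha> + k\<close> is a countable intersection of unions of a
  \<open>Pi0\<close> and a \<open>Sigma0\<close> set at \<open>osuc (2 * \<alpha>)\<close>.\<close>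

lemma Pi0_LT_le: "Pi0 Tr_space (2 * \<alpha> + 2) (LT_less (osuc (\<omega> * \<alpha> + ord_of_nat k)))"
proof -
  note base = has_clopen_base_Tr_space
  define S where "S n s = {T \<in> Tr. tall (\<omega> * \<alpha> + ord_of_nat n) (subtree s T)}" for n s
  have S: "Sigma0 Tr_space (osuc (2 * \<alpha>)) (S n s)" if "s \<noteq> []" for n s
    unfolding S_def cord_add_ord_of_nat using Delta0_subtree_tall
    by (intro Sigma0_subtree_tall_add that) (simp add: Delta0_def)
  have eq: "LT_less (osuc (\<omega> * \<alpha> + ord_of_nat k)) = (\<Inter>s\<in>{s. s \<noteq> []}. (Tr - S k s) \<union> S (Suc k) s)"
  proof (intro subset_antisym subsetI)
    fix T assume T: "T \<in> (\<Inter>s\<in>{s. s \<noteq> []}. (Tr - S k s) \<union> S (Suc k) s)"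
    \<comment> \<open>Any nonempty sequence would do; it yields membership in
      \<open>Tr\<close>.\<close>
    then have "T \<in> (Tr - S k [0]) \<union> S (Suc k) [0]" by blast
    then have "T \<in> Tr" by (auto simp: S_def)
    with T show "T \<in> LT_less (osuc (\<omega> * \<alpha> + ord_of_nat k))"
      by (auto simp: LT_less_def lusin_height_le_iff S_def cord_add_ord_of_nat)
  qed (auto simp: LT_less_def lusin_height_le_iff S_def cord_add_ord_of_nat)
  have "Pi0 Tr_space (2 * \<alpha> + 2) ((Tr - S k s) \<union> S (Suc k) s)" if s: "s \<noteq> []" for s
  proof (rule Pi0_Un[OF base])
    have "Pi0 Tr_space (osuc (2 * \<alpha>)) (Tr - S k s)"
      using S[OF s] Pi0_Compl_iff[of "S k s" Tr_space] by (simp add: S_def)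
    then show "Pi0 Tr_space (2 * \<alpha> + 2) (Tr - S k s)"
      by (rule Pi0_mono[OF base]) (simp add: cord_add_2 less_imp_le)
    show "Pi0 Tr_space (2 * \<alpha> + 2) (S (Suc k) s)"
      using S[OF s] by (rule Sigma0_imp_Pi0) (simp add: cord_add_2)
  qed
  moreover have "{s :: nat list. s \<noteq> []} \<noteq> {}" by (auto intro!: exI[of _ "[0]"])
  ultimately show ?thesis
    unfolding eq by (intro Pi0_INT[OF base countableI_type]) simp_all
qed

text \<open>The heights below \<open>\<omega> * \<alpha>\<close> form a countable union of
  \<open>Pi0\<close> sets with indices \<open>2 * \<gamma> + 2 \<le> 2 * \<alpha>\<close>. Its
  complement is therefore simple enough to be intersected without leaving the class.\<close>

lemma Pi0_LT_eq_omega_mult: "Pi0 Tr_space (2 * \<alpha> + 2) (LT_eq (\<omega> * \<alpha>))"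
proof -
  note base = has_clopen_base_Tr_space
  let ?L = "\<lambda>\<gamma> n. LT_less (osuc (\<omega> * \<gamma> + ord_of_nat n))"
  have "LT_less (\<omega> * \<alpha>) = (\<Union>\<gamma>\<in>{..<\<alpha>}. \<Union>n. ?L \<gamma> n)"
  proof (intro subset_antisym subsetI)
    fix T assume "T \<in> LT_less (\<omega> * \<alpha>)"
    then have "T \<in> Tr" "lusin_height T < \<omega> * \<alpha>" by (simp_all add: LT_less_def)
    moreover then obtain \<gamma> n where "\<gamma> < \<alpha>" "lusin_height T < \<omega> * \<gamma> + ord_of_nat n"
      using less_omega_multD by blast
    ultimately show "T \<in> (\<Union>\<gamma>\<in>{..<\<alpha>}. \<Union>n. ?L \<gamma> n)"
      by (auto simp: LT_less_def less_imp_le intro!: bexI[of _ \<gamma>] exI[of _ n])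
  qed (auto simp: LT_less_def dest: omega_mult_less intro: le_less_trans)
  moreover have "Sigma0 Tr_space (osuc (2 * \<alpha>)) (?L \<gamma> n)" if "\<gamma> < \<alpha>" for \<gamma> n
    using Pi0_LT_le
  proof (rule Pi0_imp_Sigma0)
    show "2 * \<gamma> + 2 < osuc (2 * \<alpha>)"
      using two_mult_less[OF that] by (simp add: cord_add_2)
  qed
  then have "Sigma0 Tr_space (osuc (2 * \<alpha>)) (\<Union>\<gamma>\<in>{..<\<alpha>}. \<Union>n. ?L \<gamma> n)"
    by (intro Sigma0_UN[OF base]) (auto simp: countable_lessThan_cord)
  ultimately have "Sigma0 Tr_space (osuc (2 * \<alpha>)) (LT_less (\<omega> * \<alpha>))" by simp
  then have "Pi0 Tr_space (osuc (2 * \<alpha>)) (Tr - LT_less (\<omega> * \<alpha>))"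
    using Pi0_Compl_iff[of "LT_less (\<omega> * \<alpha>)" Tr_space] by (simp add: LT_less_def)
  then have "Pi0 Tr_space (2 * \<alpha> + 2) (Tr - LT_less (\<omega> * \<alpha>))"
    by (rule Pi0_mono[OF base]) (simp add: cord_add_2 less_imp_le)
  moreover have "LT_eq (\<omega> * \<alpha>) = ?L \<alpha> 0 \<inter> (Tr - LT_less (\<omega> * \<alpha>))"
    by (auto simp: LT_eq_def LT_less_def ord_of_nat_def)
  ultimately show ?thesis using Pi0_Int[OF base Pi0_LT_le] by metis
qed

section \<open>Lower bounds and conclusion\<close>

text \<open>Hardness only requires \<open>L\<close> to separate two consecutive heights, so (i) and
  (ii) share this argument.\<close>

lemma Pi0_hard_LT:
  assumes "\<And>T. T \<in> Tr \<Longrightarrow> lusin_height T = \<omega> * \<alpha> + ord_of_nat k \<Longrightarrow> T \<in> L"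
    and "\<And>T. lusin_height T = osuc (\<omega> * \<alpha> + ord_of_nat k) \<Longrightarrow> T \<notin> L"
  shows "Pi0_hard TYPE('x) (2 * \<alpha> + 2) Tr_space L"
  unfolding Pi0_hard_def
proof (intro allI impI, elim conjE)
  fix X :: "'x topology" and A
  assume "Polish_space X" "X dim_le 0" and A: "Pi0 X (2 * \<alpha> + 2) A"
  then have base: "has_clopen_base X"
    by (auto simp: Polish_space_def intro: has_clopen_base_zero_dim)
  obtain f where f: "continuous_map X Tr_space f" "\<And>x. x \<in> topspace X \<Longrightarrow> lusin_height (f x) =
      (if x \<in> A then \<omega> * \<alpha> + ord_of_nat k else osuc (\<omega> * \<alpha> + ord_of_nat k))"
    using Pi0_height_reduction[OF base A] by metis
  have "f x \<in> L \<longleftrightarrow> x \<in> A" if "x \<in> topspace X" for x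
    using assms f(2)[OF that] continuous_map_funspace[OF f(1)] that by (auto split: if_splits)
  with Pi0_subset_topspace[OF A] f(1)
  show "\<exists>f. continuous_map X Tr_space f \<and> {x \<in> topspace X. f x \<in> L} = A" by blast
qed

theorem theorem2p5:
  fixes \<alpha> :: cord and k :: nat
  shows "Pi0_complete TYPE('x) (2 * \<alpha> + 2) Tr_space (LT_less (\<omega> * \<alpha> + ord_of_nat k + 1)) \<and>
    Pi0_complete TYPE('x) (2 * \<alpha> + 2) Tr_space (LT_eq (\<omega> * \<alpha>)) \<and>
    (Delta0 Tr_space (2 * \<alpha> + 3) (LT_eq (\<omega> * \<alpha> + ord_of_nat k + 1)) \<and>
     \<not> Sigma0 Tr_space (2 * \<alpha> + 2) (LT_eq (\<omega> * \<alpha> + ord_of_nat k + 1)) \<and>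
     \<not> Pi0 Tr_space (2 * \<alpha> + 2) (LT_eq (\<omega> * \<alpha> + ord_of_nat k + 1)) \<and>
     (\<exists>P Q. Pi0 Tr_space (2 * \<alpha> + 2) P \<and> Pi0 Tr_space (2 * \<alpha> + 2) Q \<and>
        LT_eq (\<omega> * \<alpha> + ord_of_nat k + 1) = P - Q))"
proof -
  note base = has_clopen_base_Tr_space
  let ?\<xi> = "2 * \<alpha> + 2"
  define \<beta> where "\<beta> n = \<omega> * \<alpha> + ord_of_nat n" for n
  have \<beta>_Suc: "osuc (\<beta> n) = \<beta> (Suc n)" for n by (simp add: \<beta>_def cord_add_ord_of_nat)
  have Pi: "Pi0 Tr_space ?\<xi> (LT_less (osuc (\<beta> n)))" for n
    unfolding \<beta>_def by (rule Pi0_LT_le)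
  have i: "Pi0_complete TYPE('x) ?\<xi> Tr_space (LT_less (osuc (\<beta> k)))"
    unfolding Pi0_complete_def
    by (intro conjI Pi Pi0_hard_LT[of \<alpha> k]) (auto simp: LT_less_def \<beta>_def)
  have ii: "Pi0_complete TYPE('x) ?\<xi> Tr_space (LT_eq (\<omega> * \<alpha>))"
    unfolding Pi0_complete_def
    by (intro conjI Pi0_LT_eq_omega_mult Pi0_hard_LT[of \<alpha> 0])
      (auto simp: LT_eq_def ord_of_nat_def dest: sym)
  let ?E = "LT_eq (osuc (\<beta> k))"
  \<comment> \<open>The set in (iii) is cut out by two consecutive bounds, \<open>k + 1\<close> and
    \<open>k\<close>.\<close>
  have diff: "?E = LT_less (osuc (\<beta> (Suc k))) - LT_less (osuc (\<beta> k))"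
    by (auto simp: LT_eq_def LT_less_def \<beta>_Suc[symmetric] not_le intro: order_antisym)
  have "Delta0 Tr_space (2 * \<alpha> + 3) (LT_less (osuc (\<beta> n)))" for n
    using Delta0_osuc[OF base Pi[of n]] by (simp add: cord_add_2 cord_add_3)
  then have delta: "Delta0 Tr_space (2 * \<alpha> + 3) ?E"
    unfolding diff by (intro Delta0_Diff[OF base])
  obtain A where A: "Pi0 cantor ?\<xi> A" "\<not> Sigma0 cantor ?\<xi> A"
    using Pi0_not_Sigma0[of ?\<xi>] by (auto simp: cord_add_2)
  have red: "\<exists>f. continuous_map cantor Tr_space f \<and>
      (\<forall>x. lusin_height (f x) = (if x \<in> A then \<beta> n else osuc (\<beta> n)))" for n
    using Pi0_height_reduction[OF has_clopen_base_cantor A(1), of n]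
    unfolding \<beta>_def by (simp only: topspace_cantor ball_UNIV)
  have "\<not> Sigma0 Tr_space ?\<xi> ?E"
  proof
    assume S: "Sigma0 Tr_space ?\<xi> ?E"
    \<comment> \<open>The reduction at \<open>Suc k\<close> sends exactly the points of
      \<open>A\<close> to height \<open>osuc (\<beta> k)\<close>, so \<open>A\<close> itself is the
      preimage.\<close>
    obtain f where f: "continuous_map cantor Tr_space f"
      "\<And>x. lusin_height (f x) = (if x \<in> A then \<beta> (Suc k) else osuc (\<beta> (Suc k)))"
      using red by metis
    have "f x \<in> Tr" for x using continuous_map_funspace[OF f(1)] by auto
    then have "{x \<in> topspace cantor. f x \<in> ?E} = A"
      using f(2) by (auto simp: LT_eq_def \<beta>_Suc[symmetric])
    with Sigma0_continuous_preimage[OF f(1) S] A(2) show False by simp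
  qed
  moreover have "\<not> Pi0 Tr_space ?\<xi> ?E"
  proof
    assume P: "Pi0 Tr_space ?\<xi> ?E"
    \<comment> \<open>At \<open>k\<close>, exactly the points outside \<open>A\<close> reach height
      \<open>osuc (\<beta> k)\<close>, so the preimage is the complement of
      \<open>A\<close>.\<close>
    obtain f where f: "continuous_map cantor Tr_space f"
      "\<And>x. lusin_height (f x) = (if x \<in> A then \<beta> k else osuc (\<beta> k))"
      using red by metis
    have "f x \<in> Tr" for x using continuous_map_funspace[OF f(1)] by auto
    then have "{x \<in> topspace cantor. f x \<in> ?E} = topspace cantor - A"
      using f(2) by (auto simp: LT_eq_def dest: sym split: if_splits)
    with Pi0_continuous_preimage[OF f(1) P] A(2) show False
      using Pi0_Compl_iff[of A cantor ?\<xi>] by simp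
  qed
  ultimately show ?thesis
    using i ii delta diff Pi by (auto simp: \<beta>_def cord_add_1)
qed

end
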